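(* Let $(M^n, g, X, \rho)$ be an almost Yamabe soliton, i.e. $\frac12 \mathcal{L}_X g=(R-\rho)\,g$, and put $\psi = R-\rho$. If $X$ is closed, then either (i) $X$ is a Killing vector field, or (ii) at the points where $X\neq 0$, $$\left[Dd\psi + \frac{R \psi}{n-1}\, g - \psi\, {\rm Ric}\right]\left(\frac{X}{|X|}, \frac{X}{|X|}\right) = \Delta \psi + \frac{R\psi}{n-1}.$$
   Context: An almost Yamabe soliton $(M^n,g,X,\rho)$ is a (smooth) Riemannian $n$-manifold $(M^n,g)$ together with a smooth vector field $X$ and a smooth function $\rho$ on $M$ such that $\frac12 \mathcal{L}_X g = (R-\rho)\, g$, where $\mathcal{L}$ is the Lie derivative and $R$ is the scalar curvature of $g$. $X$ is called closed if $\nabla_Y X = (R-\rho)Y$ for every vector field $Y$. $X$ is Killing if $R-\rho\equiv 0$. $Dd\psi$ denotes the Hessian of $\psi$, $\Delta\psi$ is its trace, and ${\rm Ric}$ is the Ricci tensor of $g$. *)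

theory Defs
  imports "HOL-Analysis.Analysis"
begin

section \<open>Smooth functions on open subsets of Euclidean space\<close>

text \<open>For open \<open>S\<close>: the iterated partial derivatives of \<open>f\<close> up to order \<open>k\<close> exist and are
  continuous on \<open>S\<close>, those of order less than \<open>k\<close> being differentiable.\<close>

primrec Ck_on :: "nat \<Rightarrow> ('b::euclidean_space \<Rightarrow> 'c::real_normed_vector) \<Rightarrow> 'b set \<Rightarrow> bool" where
  "Ck_on 0 f S \<longleftrightarrow> continuous_on S f"
| "Ck_on (Suc k) f S \<longleftrightarrow> f differentiable_on S \<and>
     (\<forall>b\<in>Basis. Ck_on k (\<lambda>x. frechet_derivative f (at x) b) S)"

definition Cinf_on :: "('b::euclidean_space \<Rightarrow> 'c::real_normed_vector) \<Rightarrow> 'b set \<Rightarrow> bool" where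
  "Cinf_on f S \<longleftrightarrow> open S \<and> (\<forall>k. Ck_on k f S)"

section \<open>Smooth manifolds\<close>

type_synonym ('a, 'n) chart = "'a set \<times> ('a \<Rightarrow> real ^ 'n)"

text \<open>The atlas need not be maximal; it only serves to single out the smooth functions.\<close>

definition smooth_manifold :: "'a topology \<Rightarrow> ('a, 'n::finite) chart set \<Rightarrow> bool" where
  "smooth_manifold M A \<longleftrightarrow>
     Hausdorff_space M \<and> second_countable M \<and>
     (\<Union>(U, \<phi>)\<in>A. U) = topspace M \<and>
     (\<forall>(U, \<phi>)\<in>A. openin M U \<and> open (\<phi> ` U) \<and>
        homeomorphic_map (subtopology M U) (top_of_set (\<phi> ` U)) \<phi>) \<and>
     (\<forall>(U, \<phi>)\<in>A. \<forall>(V, \<kappa>)\<in>A. Cinf_on (\<kappa> \<circ> inv_into U \<phi>) (\<phi> ` (U \<inter> V)))"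

text \<open>Functions, vector fields etc. on an open set \<open>W\<close> are represented by total functions on the
  type \<open>'a\<close>; their values outside \<open>W\<close> are irrelevant.\<close>

definition smooth_fun ::
    "'a topology \<Rightarrow> ('a, 'n::finite) chart set \<Rightarrow> 'a set \<Rightarrow> ('a \<Rightarrow> real) \<Rightarrow> bool" where
  "smooth_fun M A W f \<longleftrightarrow> openin M W \<and>
     (\<forall>(U, \<phi>)\<in>A. Cinf_on (f \<circ> inv_into U \<phi>) (\<phi> ` (U \<inter> W)))"

definition smooth_near ::
    "'a topology \<Rightarrow> ('a, 'n::finite) chart set \<Rightarrow> 'a \<Rightarrow> ('a \<Rightarrow> real) \<Rightarrow> bool" where
  "smooth_near M A p f \<longleftrightarrow> (\<exists>W. p \<in> W \<and> smooth_fun M A W f)"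

text \<open>Tangent vectors at \<open>p\<close> are the derivations at \<open>p\<close> of the algebra of functions that are smooth
  near \<open>p\<close>. They are set to \<open>0\<close> on all other functions, so that equality of tangent vectors is
  equality in the type.\<close>

type_synonym 'a tangent = "('a \<Rightarrow> real) \<Rightarrow> real"

definition tangent_space ::
    "'a topology \<Rightarrow> ('a, 'n::finite) chart set \<Rightarrow> 'a \<Rightarrow> 'a tangent set" where
  "tangent_space M A p = {v.
     (\<forall>f. \<not> smooth_near M A p f \<longrightarrow> v f = 0) \<and>
     (\<forall>f h. smooth_near M A p f \<longrightarrow> smooth_near M A p h \<longrightarrow>
        v (\<lambda>q. f q + h q) = v f + v h \<and>
        v (\<lambda>q. f q * h q) = f p * v h + h p * v f) \<and>
     (\<forall>f c. smooth_near M A p f \<longrightarrow> v (\<lambda>q. c * f q) = c * v f)}"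

definition tzero :: "'a tangent" where
  "tzero = (\<lambda>f. 0)"

definition tadd :: "'a tangent \<Rightarrow> 'a tangent \<Rightarrow> 'a tangent" where
  "tadd v w = (\<lambda>f. v f + w f)"

definition tdiff :: "'a tangent \<Rightarrow> 'a tangent \<Rightarrow> 'a tangent" where
  "tdiff v w = (\<lambda>f. v f - w f)"

definition tscale :: "real \<Rightarrow> 'a tangent \<Rightarrow> 'a tangent" where
  "tscale c v = (\<lambda>f. c * v f)"

definition vector_field ::
    "'a topology \<Rightarrow> ('a, 'n::finite) chart set \<Rightarrow> 'a set \<Rightarrow> ('a \<Rightarrow> 'a tangent) \<Rightarrow> bool" where
  "vector_field M A W Y \<longleftrightarrow> openin M W \<and>
     (\<forall>q\<in>W. Y q \<in> tangent_space M A q) \<and>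
     (\<forall>V f. V \<subseteq> W \<longrightarrow> smooth_fun M A V f \<longrightarrow> smooth_fun M A V (\<lambda>q. Y q f))"

definition lie_bracket ::
    "'a topology \<Rightarrow> ('a, 'n::finite) chart set \<Rightarrow>
     ('a \<Rightarrow> 'a tangent) \<Rightarrow> ('a \<Rightarrow> 'a tangent) \<Rightarrow> 'a \<Rightarrow> 'a tangent" where
  "lie_bracket M A Y Z p =
     (\<lambda>f. if smooth_near M A p f then Y p (\<lambda>q. Z q f) - Z p (\<lambda>q. Y q f) else 0)"

section \<open>Riemannian metrics and the Levi-Civita connection\<close>

definition riemannian_metric ::
    "'a topology \<Rightarrow> ('a, 'n::finite) chart set \<Rightarrow>
     ('a \<Rightarrow> 'a tangent \<Rightarrow> 'a tangent \<Rightarrow> real) \<Rightarrow> bool" where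
  "riemannian_metric M A g \<longleftrightarrow>
     (\<forall>p\<in>topspace M. \<forall>u\<in>tangent_space M A p. \<forall>v\<in>tangent_space M A p.
        g p u v = g p v u \<and>
        (\<forall>w\<in>tangent_space M A p. g p (tadd u v) w = g p u w + g p v w) \<and>
        (\<forall>c. g p (tscale c u) v = c * g p u v) \<and>
        (u \<noteq> tzero \<longrightarrow> g p u u > 0)) \<and>
     (\<forall>W Y Z. vector_field M A W Y \<longrightarrow> vector_field M A W Z \<longrightarrow>
        smooth_fun M A W (\<lambda>q. g q (Y q) (Z q)))"

text \<open>\<open>D p v Y\<close> stands for the covariant derivative of the vector field \<open>Y\<close> in the direction of the
  tangent vector \<open>v\<close> at \<open>p\<close>. The field \<open>Y\<close> only has to be defined and smooth on an open set
  containing \<open>p\<close>, i.e. the usual extension of a connection to local fields is built in.\<close>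

definition affine_connection ::
    "'a topology \<Rightarrow> ('a, 'n::finite) chart set \<Rightarrow>
     ('a \<Rightarrow> 'a tangent \<Rightarrow> ('a \<Rightarrow> 'a tangent) \<Rightarrow> 'a tangent) \<Rightarrow> bool" where
  "affine_connection M A D \<longleftrightarrow>
     (\<forall>W Y. vector_field M A W Y \<longrightarrow>
        (\<forall>p\<in>W. \<forall>u\<in>tangent_space M A p.
           D p u Y \<in> tangent_space M A p \<and>
           (\<forall>v\<in>tangent_space M A p. D p (tadd u v) Y = tadd (D p u Y) (D p v Y)) \<and>
           (\<forall>c. D p (tscale c u) Y = tscale c (D p u Y)) \<and>
           (\<forall>Z. vector_field M A W Z \<longrightarrow>
              D p u (\<lambda>q. tadd (Y q) (Z q)) = tadd (D p u Y) (D p u Z)) \<and>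
           (\<forall>f. smooth_fun M A W f \<longrightarrow>
              D p u (\<lambda>q. tscale (f q) (Y q)) = tadd (tscale (u f) (Y p)) (tscale (f p) (D p u Y)))) \<and>
        (\<forall>V. vector_field M A W V \<longrightarrow> vector_field M A W (\<lambda>q. D q (V q) Y)))"

definition levi_civita ::
    "'a topology \<Rightarrow> ('a, 'n::finite) chart set \<Rightarrow>
     ('a \<Rightarrow> 'a tangent \<Rightarrow> 'a tangent \<Rightarrow> real) \<Rightarrow>
     ('a \<Rightarrow> 'a tangent \<Rightarrow> ('a \<Rightarrow> 'a tangent) \<Rightarrow> 'a tangent) \<Rightarrow> bool" where
  "levi_civita M A g D \<longleftrightarrow> affine_connection M A D \<and>
     (\<forall>W Y Z. vector_field M A W Y \<longrightarrow> vector_field M A W Z \<longrightarrow>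
        (\<forall>p\<in>W. tdiff (D p (Y p) Z) (D p (Z p) Y) = lie_bracket M A Y Z p \<and>
          (\<forall>v\<in>tangent_space M A p.
             v (\<lambda>q. g q (Y q) (Z q)) = g p (D p v Y) (Z p) + g p (Y p) (D p v Z))))"

section \<open>Curvature, Hessian and traces\<close>

text \<open>Some vector field, smooth near \<open>p\<close>, with value \<open>v\<close> at \<open>p\<close>. It is only used in tensorial
  expressions, whose value at \<open>p\<close> does not depend on the choice.\<close>

definition extension ::
    "'a topology \<Rightarrow> ('a, 'n::finite) chart set \<Rightarrow> 'a \<Rightarrow> 'a tangent \<Rightarrow> 'a \<Rightarrow> 'a tangent" where
  "extension M A p v = (SOME V. \<exists>W. p \<in> W \<and> vector_field M A W V \<and> V p = v)"

text \<open>\<open>R(X,Y)Z = \<nabla>\<^sub>X \<nabla>\<^sub>Y Z - \<nabla>\<^sub>Y \<nabla>\<^sub>X Z - \<nabla>\<^bsub>[X,Y]\<^esub> Z\<close>\<close>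

definition curvature_field ::
    "'a topology \<Rightarrow> ('a, 'n::finite) chart set \<Rightarrow>
     ('a \<Rightarrow> 'a tangent \<Rightarrow> ('a \<Rightarrow> 'a tangent) \<Rightarrow> 'a tangent) \<Rightarrow>
     ('a \<Rightarrow> 'a tangent) \<Rightarrow> ('a \<Rightarrow> 'a tangent) \<Rightarrow> ('a \<Rightarrow> 'a tangent) \<Rightarrow> 'a \<Rightarrow> 'a tangent" where
  "curvature_field M A D X Y Z p =
     tdiff (tdiff (D p (X p) (\<lambda>q. D q (Y q) Z)) (D p (Y p) (\<lambda>q. D q (X q) Z)))
           (D p (lie_bracket M A X Y p) Z)"

definition curvature ::
    "'a topology \<Rightarrow> ('a, 'n::finite) chart set \<Rightarrow>
     ('a \<Rightarrow> 'a tangent \<Rightarrow> ('a \<Rightarrow> 'a tangent) \<Rightarrow> 'a tangent) \<Rightarrow>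
     'a \<Rightarrow> 'a tangent \<Rightarrow> 'a tangent \<Rightarrow> 'a tangent \<Rightarrow> 'a tangent" where
  "curvature M A D p u v w =
     curvature_field M A D (extension M A p u) (extension M A p v) (extension M A p w) p"

text \<open>The metric trace of a bilinear form on the tangent space, computed in an orthonormal basis;
  it does not depend on the basis.\<close>

definition orthonormal_basis ::
    "'a topology \<Rightarrow> ('a, 'n::finite) chart set \<Rightarrow>
     ('a \<Rightarrow> 'a tangent \<Rightarrow> 'a tangent \<Rightarrow> real) \<Rightarrow> 'a \<Rightarrow> ('n \<Rightarrow> 'a tangent) \<Rightarrow> bool" where
  "orthonormal_basis M A g p e \<longleftrightarrow>
     (\<forall>i. e i \<in> tangent_space M A p) \<and>
     (\<forall>i j. g p (e i) (e j) = (if i = j then 1 else 0))"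

definition metric_trace ::
    "'a topology \<Rightarrow> ('a, 'n::finite) chart set \<Rightarrow>
     ('a \<Rightarrow> 'a tangent \<Rightarrow> 'a tangent \<Rightarrow> real) \<Rightarrow> 'a \<Rightarrow>
     ('a tangent \<Rightarrow> 'a tangent \<Rightarrow> real) \<Rightarrow> real" where
  "metric_trace M A g p B =
     (let e = (SOME e. orthonormal_basis M A g p e) in \<Sum>i\<in>UNIV. B (e i) (e i))"

text \<open>\<open>Ric(u,v)\<close> is the trace of the endomorphism \<open>w \<mapsto> R(w,u)v\<close>.\<close>

definition ricci ::
    "'a topology \<Rightarrow> ('a, 'n::finite) chart set \<Rightarrow>
     ('a \<Rightarrow> 'a tangent \<Rightarrow> 'a tangent \<Rightarrow> real) \<Rightarrow>
     ('a \<Rightarrow> 'a tangent \<Rightarrow> ('a \<Rightarrow> 'a tangent) \<Rightarrow> 'a tangent) \<Rightarrow>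
     'a \<Rightarrow> 'a tangent \<Rightarrow> 'a tangent \<Rightarrow> real" where
  "ricci M A g D p u v = metric_trace M A g p (\<lambda>w w'. g p (curvature M A D p w u v) w')"

definition scalar_curvature ::
    "'a topology \<Rightarrow> ('a, 'n::finite) chart set \<Rightarrow>
     ('a \<Rightarrow> 'a tangent \<Rightarrow> 'a tangent \<Rightarrow> real) \<Rightarrow>
     ('a \<Rightarrow> 'a tangent \<Rightarrow> ('a \<Rightarrow> 'a tangent) \<Rightarrow> 'a tangent) \<Rightarrow> 'a \<Rightarrow> real" where
  "scalar_curvature M A g D p = metric_trace M A g p (ricci M A g D p)"

text \<open>\<open>Dd\<psi>(u,V) = u(V\<psi>) - (\<nabla>\<^sub>u V)\<psi>\<close>\<close>

definition hessian ::
    "'a topology \<Rightarrow> ('a, 'n::finite) chart set \<Rightarrow>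
     ('a \<Rightarrow> 'a tangent \<Rightarrow> ('a \<Rightarrow> 'a tangent) \<Rightarrow> 'a tangent) \<Rightarrow>
     ('a \<Rightarrow> real) \<Rightarrow> 'a \<Rightarrow> 'a tangent \<Rightarrow> 'a tangent \<Rightarrow> real" where
  "hessian M A D \<psi> p u v =
     (let V = extension M A p v in u (\<lambda>q. V q \<psi>) - D p u V \<psi>)"

definition laplacian ::
    "'a topology \<Rightarrow> ('a, 'n::finite) chart set \<Rightarrow>
     ('a \<Rightarrow> 'a tangent \<Rightarrow> 'a tangent \<Rightarrow> real) \<Rightarrow>
     ('a \<Rightarrow> 'a tangent \<Rightarrow> ('a \<Rightarrow> 'a tangent) \<Rightarrow> 'a tangent) \<Rightarrow> ('a \<Rightarrow> real) \<Rightarrow> 'a \<Rightarrow> real" where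
  "laplacian M A g D \<psi> p = metric_trace M A g p (hessian M A D \<psi> p)"

section \<open>Almost Yamabe solitons\<close>

text \<open>\<open>(L\<^sub>X g)(Y,Z) = X(g(Y,Z)) - g([X,Y],Z) - g(Y,[X,Z])\<close>\<close>

definition lie_derivative_metric ::
    "'a topology \<Rightarrow> ('a, 'n::finite) chart set \<Rightarrow>
     ('a \<Rightarrow> 'a tangent \<Rightarrow> 'a tangent \<Rightarrow> real) \<Rightarrow> ('a \<Rightarrow> 'a tangent) \<Rightarrow>
     ('a \<Rightarrow> 'a tangent) \<Rightarrow> ('a \<Rightarrow> 'a tangent) \<Rightarrow> 'a \<Rightarrow> real" where
  "lie_derivative_metric M A g X Y Z p =
     X p (\<lambda>q. g q (Y q) (Z q)) - g p (lie_bracket M A X Y p) (Z p)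
       - g p (Y p) (lie_bracket M A X Z p)"

text \<open>\<open>D\<close> is the Levi-Civita connection of \<open>g\<close>; it is carried along as a parameter because its values
  outside the intended domain (tangent vectors at \<open>p\<close>, fields smooth near \<open>p\<close>) are arbitrary.\<close>

definition almost_yamabe_soliton ::
    "'a topology \<Rightarrow> ('a, 'n::finite) chart set \<Rightarrow>
     ('a \<Rightarrow> 'a tangent \<Rightarrow> 'a tangent \<Rightarrow> real) \<Rightarrow>
     ('a \<Rightarrow> 'a tangent \<Rightarrow> ('a \<Rightarrow> 'a tangent) \<Rightarrow> 'a tangent) \<Rightarrow>
     ('a \<Rightarrow> 'a tangent) \<Rightarrow> ('a \<Rightarrow> real) \<Rightarrow> bool" where
  "almost_yamabe_soliton M A g D X \<rho> \<longleftrightarrow>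
     smooth_manifold M A \<and> riemannian_metric M A g \<and> levi_civita M A g D \<and>
     vector_field M A (topspace M) X \<and> smooth_fun M A (topspace M) \<rho> \<and>
     (\<forall>Y Z. vector_field M A (topspace M) Y \<longrightarrow> vector_field M A (topspace M) Z \<longrightarrow>
        (\<forall>p\<in>topspace M. 1 / 2 * lie_derivative_metric M A g X Y Z p =
           (scalar_curvature M A g D p - \<rho> p) * g p (Y p) (Z p)))"

text \<open>\<open>\<nabla>\<^sub>Y X\<close> at \<open>p\<close> depends on \<open>Y\<close> only through its value at \<open>p\<close>, so all \<open>Y\<close> are covered by all
  tangent vectors \<open>v\<close>.\<close>

definition closed_soliton_field ::
    "'a topology \<Rightarrow> ('a, 'n::finite) chart set \<Rightarrow>
     ('a \<Rightarrow> 'a tangent \<Rightarrow> 'a tangent \<Rightarrow> real) \<Rightarrow>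
     ('a \<Rightarrow> 'a tangent \<Rightarrow> ('a \<Rightarrow> 'a tangent) \<Rightarrow> 'a tangent) \<Rightarrow>
     ('a \<Rightarrow> 'a tangent) \<Rightarrow> ('a \<Rightarrow> real) \<Rightarrow> bool" where
  "closed_soliton_field M A g D X \<rho> \<longleftrightarrow>
     (\<forall>p\<in>topspace M. \<forall>v\<in>tangent_space M A p.
        D p v X = tscale (scalar_curvature M A g D p - \<rho> p) v)"

text \<open>As \<open>1/2 L\<^sub>X g = (R - \<rho>) g\<close>, the field \<open>X\<close> is Killing iff \<open>R - \<rho>\<close> vanishes identically; for
  solitons this is taken as the definition.\<close>

definition killing_soliton_field ::
    "'a topology \<Rightarrow> ('a, 'n::finite) chart set \<Rightarrow>
     ('a \<Rightarrow> 'a tangent \<Rightarrow> 'a tangent \<Rightarrow> real) \<Rightarrow>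
     ('a \<Rightarrow> 'a tangent \<Rightarrow> ('a \<Rightarrow> 'a tangent) \<Rightarrow> 'a tangent) \<Rightarrow>
     ('a \<Rightarrow> 'a tangent) \<Rightarrow> ('a \<Rightarrow> real) \<Rightarrow> bool" where
  "killing_soliton_field M A g D X \<rho> \<longleftrightarrow>
     (\<forall>p\<in>topspace M. scalar_curvature M A g D p - \<rho> p = 0)"

end

theory Submission
  imports Defs
begin

text \<open>Put \<open>a = |X|\<^sup>2\<close> and \<open>b = X\<psi>\<close>. As \<open>X\<close> is closed, \<open>R(Y,Z)X = (Y\<psi>) Z - (Z\<psi>) Y\<close>. Tracing gives
  \<open>a Ric(u,u) = -(n-1) b\<close> for \<open>u = X/|X|\<close>, and \<open>g(R(X,Y)X, X) = 0\<close> gives \<open>a (Y\<psi>) = b g(X,Y)\<close>, so the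
  gradient of \<open>\<psi>\<close> is parallel to \<open>X\<close>. Differentiating the last identity expresses the Hessian:
  \<open>a Dd\<psi>(w,v) = (wb) g(v,X) + b \<psi> g(v,w) - 2 \<psi> g(w,X) (v\<psi>)\<close>. Hence
  \<open>a Dd\<psi>(u,u) = Xb + b \<psi> - 2 b \<psi>\<close> and \<open>a \<Delta>\<psi> = Xb + n b \<psi> - 2 b \<psi>\<close>, which differ by
  \<open>(n-1) b \<psi> = - a \<psi> Ric(u,u)\<close>. So alternative (ii) always holds.\<close>

section \<open>Calculus of smooth functions\<close>

text \<open>Tangent vectors are derivations, and \<open>extension\<close> and
  \<open>metric_trace\<close> choose fields and orthonormal bases with \<open>SOME\<close>, so
  suitable choices must first be shown to exist. This rests on Hadamard's lemma: a derivation is a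
  combination of the \<open>CARD('n)\<close> coordinate derivatives. The geometric part is then
  arranged so that the choices drop out. In \<open>Ric(u,u)\<close> the third argument of the
  curvature is an extension of \<open>u\<close>, which is a multiple of \<open>X\<close> only at
  \<open>p\<close>; skew-symmetry moves it into a slot of the metric, where only its value at
  \<open>p\<close> counts. In the Hessian the covariant derivative of the extension cancels by the
  gradient identity. The Ricci trace and the Laplacian sum over one and the same chosen basis. The
  identities are kept multiplied by \<open>a\<close> instead of being divided by it: in this form
  they hold at zeros of \<open>X\<close> too and can be differentiated. Division by \<open>a\<close>
  happens once, at a point with \<open>X p \<noteq> tzero\<close>.\<close>

lemma Ck_on_cong:
  assumes "open S" "\<And>x. x \<in> S \<Longrightarrow> f x = g x"
  shows "Ck_on k f S \<longleftrightarrow> Ck_on k g S"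
  using assms(2)
proof (induction k arbitrary: f g)
  case 0
  then show ?case by (simp cong: continuous_on_cong)
next
  case (Suc k)
  have deriv: "(f has_derivative f') (at x) \<longleftrightarrow> (g has_derivative f') (at x)" if "x \<in> S" for x f'
    using has_derivative_transform_within_open[of f f' x UNIV S g]
      has_derivative_transform_within_open[of g f' x UNIV S f] \<open>open S\<close> that Suc.prems by auto
  have "f differentiable_on S \<longleftrightarrow> g differentiable_on S"
    using deriv at_within_open[OF _ \<open>open S\<close>] by (simp add: differentiable_on_def differentiable_def)
  moreover have "frechet_derivative f (at x) b = frechet_derivative g (at x) b" if "x \<in> S" for x b
    using deriv[OF that] by (simp add: frechet_derivative_def)
  then have "Ck_on k (\<lambda>x. frechet_derivative f (at x) b) S \<longleftrightarrow>
      Ck_on k (\<lambda>x. frechet_derivative g (at x) b) S" for b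
    by (rule Suc.IH)
  ultimately show ?case by simp
qed

lemma Ck_on_subset:
  assumes "Ck_on k f S" "T \<subseteq> S"
  shows "Ck_on k f T"
  using assms(1)
proof (induction k arbitrary: f)
  case 0
  then show ?case using assms(2) continuous_on_subset by auto
next
  case (Suc k)
  then show ?case using differentiable_on_subset[OF _ assms(2)] by auto
qed

text \<open>Derivatives on an open set are unique, so an explicit formula \<open>f'\<close> may
  replace \<open>frechet_derivative\<close>. The inductive steps below go through this rule.\<close>

lemma Ck_on_SucI:
  assumes "open S" "\<And>x. x \<in> S \<Longrightarrow> (f has_derivative f' x) (at x)"
    and "\<And>b. b \<in> Basis \<Longrightarrow> Ck_on k (\<lambda>x. f' x b) S"
  shows "Ck_on (Suc k) f S"
proof -
  have "f differentiable_on S"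
    using assms(2) at_within_open[OF _ \<open>open S\<close>] by (auto simp: differentiable_on_def differentiable_def)
  moreover have "frechet_derivative f (at x) = f' x" if "x \<in> S" for x
    using frechet_derivative_at[OF assms(2)[OF that]] by simp
  ultimately show ?thesis
    using assms(3) Ck_on_cong[OF \<open>open S\<close>, of "\<lambda>x. frechet_derivative f (at x) b" "\<lambda>x. f' x b" k for b]
    by simp
qed

lemma Ck_on_Suc_has_derivative:
  assumes "Ck_on (Suc k) f S" "open S" "x \<in> S"
  shows "(f has_derivative frechet_derivative f (at x)) (at x)"
  using assms at_within_open[OF assms(3,2)] frechet_derivative_works[of f "at x"]
  by (auto simp: differentiable_on_def)

lemma Ck_on_SucD: "Ck_on (Suc k) f S \<Longrightarrow> Ck_on k f S"
proof (induction k arbitrary: f)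
  case 0
  then show ?case by (simp add: differentiable_imp_continuous_on)
next
  case (Suc k)
  have "Ck_on k (\<lambda>x. frechet_derivative f (at x) b) S" if "b \<in> Basis" for b
    by (rule Suc.IH) (use Suc.prems that in simp)
  then show ?case using Suc.prems by simp
qed

lemma Ck_on_continuous: "Ck_on k f S \<Longrightarrow> continuous_on S f"
  by (induction k) (simp, blast dest: Ck_on_SucD)

lemma Ck_on_const: "open S \<Longrightarrow> Ck_on k (\<lambda>x. c) S"
proof (induction k arbitrary: c)
  case (Suc k)
  then show ?case by (intro Ck_on_SucI[where f' = "\<lambda>x b. 0"]) simp_all
qed simp

lemma Ck_on_bounded_linear_comp:
  assumes "bounded_linear h" "open S" "Ck_on k f S"
  shows "Ck_on k (\<lambda>x. h (f x)) S"
  using assms(3)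
proof (induction k arbitrary: f)
  case 0
  then show ?case using bounded_linear.continuous_on[OF assms(1)] by simp
next
  case (Suc k)
  show ?case
    by (rule Ck_on_SucI[OF \<open>open S\<close> bounded_linear.has_derivative[OF assms(1)
          Ck_on_Suc_has_derivative[OF Suc.prems \<open>open S\<close>]]])
       (use Suc.prems in \<open>simp_all add: Suc.IH\<close>)
qed

lemma Ck_on_add:
  assumes "open S" "Ck_on k f S" "Ck_on k g S"
  shows "Ck_on k (\<lambda>x. f x + g x) S"
  using assms(2,3)
proof (induction k arbitrary: f g)
  case 0
  then show ?case by (simp add: continuous_on_add)
next
  case (Suc k)
  show ?case
    by (rule Ck_on_SucI[OF \<open>open S\<close> has_derivative_add[OF
          Ck_on_Suc_has_derivative[OF Suc.prems(1) \<open>open S\<close>]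
          Ck_on_Suc_has_derivative[OF Suc.prems(2) \<open>open S\<close>]]])
       (use Suc.prems in \<open>simp_all add: Suc.IH\<close>)
qed

lemma Ck_on_sum:
  assumes "open S" "\<And>i. i \<in> I \<Longrightarrow> Ck_on k (f i) S"
  shows "Ck_on k (\<lambda>x. \<Sum>i\<in>I. f i x) S"
  using assms(2)
  by (induction I rule: infinite_finite_induct) (simp_all add: Ck_on_const Ck_on_add assms(1))

lemma Ck_on_bilinear:
  fixes f :: "'e::euclidean_space \<Rightarrow> 'x::real_normed_vector" and g :: "'e \<Rightarrow> 'y::real_normed_vector"
  assumes "bounded_bilinear m" "open S" "Ck_on k f S" "Ck_on k g S"
  shows "Ck_on k (\<lambda>x. m (f x) (g x)) S"
  using assms(3,4)
proof (induction k arbitrary: f g)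
  case 0
  then show ?case using bounded_bilinear.continuous_on[OF assms(1)] by simp
next
  case (Suc k)
  show ?case
  proof (rule Ck_on_SucI[OF \<open>open S\<close> bounded_bilinear.FDERIV[OF assms(1)
          Ck_on_Suc_has_derivative[OF Suc.prems(1) \<open>open S\<close>]
          Ck_on_Suc_has_derivative[OF Suc.prems(2) \<open>open S\<close>]]])
    fix b :: 'e assume "b \<in> Basis"
    then show "Ck_on k (\<lambda>x. m (f x) (frechet_derivative g (at x) b) +
        m (frechet_derivative f (at x) b) (g x)) S"
      using Suc.prems Ck_on_SucD[OF Suc.prems(1)] Ck_on_SucD[OF Suc.prems(2)]
      by (intro Ck_on_add Suc.IH assms(2)) simp_all
  qed
qed

lemma linear_eq_sum_Basis:
  assumes "linear L"
  shows "L x = (\<Sum>b\<in>Basis. (x \<bullet> b) *\<^sub>R L b)"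
  by (subst euclidean_representation[of x, symmetric]) (simp add: linear_sum[OF assms] linear_scale[OF assms])

text \<open>\<open>Ck_on\<close> controls only derivatives along basis vectors; linearity of the
  derivative gives the other directions.\<close>

lemma Ck_on_frechet_derivative:
  assumes "open S" "Ck_on (Suc k) f S"
  shows "Ck_on k (\<lambda>x. frechet_derivative f (at x) v) S"
proof -
  have "frechet_derivative f (at x) v = (\<Sum>b\<in>Basis. (v \<bullet> b) *\<^sub>R frechet_derivative f (at x) b)"
    if "x \<in> S" for x
    by (rule linear_eq_sum_Basis)
       (rule has_derivative_linear[OF Ck_on_Suc_has_derivative[OF assms(2,1) that]])
  moreover have "Ck_on k (\<lambda>x. \<Sum>b\<in>Basis. (v \<bullet> b) *\<^sub>R frechet_derivative f (at x) b) S"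
    using assms by (intro Ck_on_sum Ck_on_bounded_linear_comp[OF bounded_linear_scaleR_right]) simp_all
  ultimately show ?thesis
    using Ck_on_cong[OF assms(1), of "\<lambda>x. frechet_derivative f (at x) v"
        "\<lambda>x. \<Sum>b\<in>Basis. (v \<bullet> b) *\<^sub>R frechet_derivative f (at x) b" k]
    by simp
qed

lemma Ck_on_compose:
  assumes "open S" "open T" "h ` S \<subseteq> T" "Ck_on k h S" "Ck_on k f T"
  shows "Ck_on k (\<lambda>x. f (h x)) S"
  using assms(4,5)
proof (induction k arbitrary: f)
  case 0
  then show ?case using assms(3) continuous_on_compose2 by auto
next
  case (Suc k)
  let ?h' = "\<lambda>x. frechet_derivative h (at x)" and ?f' = "\<lambda>y. frechet_derivative f (at y)"
  note h = Ck_on_Suc_has_derivative[OF Suc.prems(1) \<open>open S\<close>]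
  note f = Ck_on_Suc_has_derivative[OF Suc.prems(2) \<open>open T\<close>]
  have "((\<lambda>x. f (h x)) has_derivative (\<lambda>b. ?f' (h x) (?h' x b))) (at x)" if "x \<in> S" for x
    using has_derivative_compose[OF h[OF that] f] that assms(3) by auto
  \<comment> \<open>Split over the basis, the chain rule becomes a sum of products of a component of
    the derivative of \<open>h\<close> and a partial derivative of \<open>f\<close> composed with
    \<open>h\<close>. The induction hypothesis applies to the latter.\<close>
  moreover have "?f' (h x) (?h' x b) = (\<Sum>c\<in>Basis. (?h' x b \<bullet> c) *\<^sub>R ?f' (h x) c)" if "x \<in> S" for x b
    using linear_eq_sum_Basis[OF has_derivative_linear[OF f]] that assms(3) by blast
  ultimately have d: "((\<lambda>x. f (h x)) has_derivative
      (\<lambda>b. \<Sum>c\<in>Basis. (?h' x b \<bullet> c) *\<^sub>R ?f' (h x) c)) (at x)" if "x \<in> S" for x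
    using that by simp
  show ?case
  proof (rule Ck_on_SucI[OF \<open>open S\<close> d], assumption)
    fix b :: 'a assume "b \<in> Basis"
    then have "Ck_on k (\<lambda>x. ?h' x b) S" using Suc.prems(1) by simp
    then show "Ck_on k (\<lambda>x. \<Sum>c\<in>Basis. (?h' x b \<bullet> c) *\<^sub>R ?f' (h x) c) S"
      using Suc.prems(2) Ck_on_SucD[OF Suc.prems(1)]
      by (intro Ck_on_sum Ck_on_bilinear[OF bounded_bilinear_scaleR] \<open>open S\<close>
          Ck_on_bounded_linear_comp[OF bounded_linear_inner_left] Suc.IH) simp_all
  qed
qed

section \<open>Integrals along rays from the origin\<close>

lemma scaleR_mem_ball_0:
  fixes x :: "'b::real_normed_vector"
  assumes "x \<in> ball 0 r" "t \<in> {0..1}"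
  shows "t *\<^sub>R x \<in> ball 0 r"
proof -
  have "\<bar>t\<bar> * norm x \<le> 1 * norm x"
    using assms by (intro mult_right_mono) auto
  then show ?thesis using assms by simp
qed

text \<open>Differentiating \<open>F (t *\<^sub>R x)\<close> in \<open>x\<close> produces a factor
  \<open>t\<close>. With the weight \<open>t ^ m\<close> built in, a partial derivative of the
  integral is again of this form, with a partial derivative of \<open>F\<close> and
  \<open>Suc m\<close>, so the induction on \<open>k\<close> closes.\<close>

lemma Ck_on_radial_integral:
  fixes F :: "'b::euclidean_space \<Rightarrow> real"
  assumes "Ck_on k F (ball 0 r)"
  shows "Ck_on k (\<lambda>x. integral {0..1} (\<lambda>t. t ^ m * F (t *\<^sub>R x))) (ball 0 r)"
proof -
  let ?B = "ball (0::'b) r"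
  note scaled = scaleR_mem_ball_0[where 'b = 'b and r = r]
  have cont: "continuous_on (?B \<times> {0..1}) (\<lambda>(x, t). t ^ m * G (t *\<^sub>R x))"
    if "continuous_on ?B G" for G :: "'b \<Rightarrow> real" and m
    unfolding split_beta
    by (intro continuous_intros continuous_on_compose2[OF that]) (use scaled in auto)
  show ?thesis
    using assms
  proof (induction k arbitrary: F m)
    case 0
    show ?case
      using integral_continuous_on_param[of ?B 0 1 "\<lambda>x t. t ^ m * F (t *\<^sub>R x)"] cont 0 by simp
  next
    case (Suc k)
    let ?F' = "\<lambda>x. frechet_derivative F (at x)"
    note F' = Ck_on_Suc_has_derivative[OF Suc.prems open_ball]
    have F'_cont: "continuous_on ?B (\<lambda>x. ?F' x b)" if "b \<in> Basis" for b
      using Suc.prems Ck_on_continuous that by auto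
    \<comment> \<open>The Leibniz rule for parameter integrals wants the derivatives in
      \<open>x\<close> as a continuous family of bounded linear maps. The exponent
      \<open>Suc m\<close> absorbs the inner factor \<open>t\<close>.\<close>
    define G where "G x t = Blinfun (\<lambda>b. t ^ Suc m * ?F' (t *\<^sub>R x) b)" for x t
    have G: "blinfun_apply (G x t) = (\<lambda>b. t ^ Suc m * ?F' (t *\<^sub>R x) b)"
      if "x \<in> ?B" "t \<in> {0..1}" for x t
      unfolding G_def
      by (intro bounded_linear_Blinfun_apply bounded_linear_const_mult
          has_derivative_bounded_linear[OF F'] scaled that)
    have G_cont: "continuous_on (?B \<times> {0..1}) (\<lambda>(x, t). G x t)"
    proof (rule continuous_on_blinfun_componentwise)
      fix b :: 'b assume "b \<in> Basis"
      have "continuous_on (?B \<times> {0..1}) (\<lambda>(x, t). t ^ Suc m * ?F' (t *\<^sub>R x) b)"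
        by (rule cont[OF F'_cont[OF \<open>b \<in> Basis\<close>]])
      then show "continuous_on (?B \<times> {0..1}) (\<lambda>z. blinfun_apply (case z of (x, t) \<Rightarrow> G x t) b)"
        by (rule continuous_on_eq) (auto simp: G)
    qed
    have G_integrable: "G x integrable_on {0..1}" if "x \<in> ?B" for x
    proof -
      have "continuous_on {0..1} (\<lambda>t. case (x, t) of (x, t) \<Rightarrow> G x t)"
        by (rule continuous_on_compose2[OF G_cont]) (use that in \<open>auto intro!: continuous_intros\<close>)
      then show ?thesis by (simp add: integrable_continuous_real)
    qed
    have F_integrable: "(\<lambda>t. t ^ m * F (t *\<^sub>R x)) integrable_on {0..1}" if "x \<in> ?B" for x
    proof -
      have "continuous_on {0..1} (\<lambda>t. case (x, t) of (x, t) \<Rightarrow> t ^ m * F (t *\<^sub>R x))"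
        by (rule continuous_on_compose2[OF cont[OF Ck_on_continuous[OF Suc.prems]]])
           (use that in \<open>auto intro!: continuous_intros\<close>)
      then show ?thesis by (simp add: integrable_continuous_real)
    qed
    have "((\<lambda>x. t ^ m * F (t *\<^sub>R x)) has_derivative blinfun_apply (G x t)) (at x within ?B)"
      if "x \<in> ?B" "t \<in> {0..1}" for x t
    proof -
      have "((\<lambda>x. F (t *\<^sub>R x)) has_derivative (\<lambda>b. ?F' (t *\<^sub>R x) (t *\<^sub>R b))) (at x within ?B)"
        by (rule has_derivative_compose[of "\<lambda>x. t *\<^sub>R x" _ _ ?B F])
           (use F'[OF scaled[OF that]] in \<open>auto intro!: derivative_eq_intros\<close>)
      then have "((\<lambda>x. t ^ m * F (t *\<^sub>R x)) has_derivative (\<lambda>b. t ^ m * ?F' (t *\<^sub>R x) (t *\<^sub>R b)))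
          (at x within ?B)"
        by (rule has_derivative_mult_right)
      moreover have "?F' (t *\<^sub>R x) (t *\<^sub>R b) = t * ?F' (t *\<^sub>R x) b" for b
        using linear_scale[OF has_derivative_linear[OF F'[OF scaled[OF that]]]] by simp
      ultimately show ?thesis by (simp add: G[OF that] mult.assoc mult.left_commute)
    qed
    then have deriv: "((\<lambda>x. integral {0..1} (\<lambda>t. t ^ m * F (t *\<^sub>R x))) has_derivative
        blinfun_apply (integral {0..1} (G x))) (at x within ?B)" if "x \<in> ?B" for x
      using leibniz_rule[of ?B 0 1 "\<lambda>x t. t ^ m * F (t *\<^sub>R x)" G x] G_cont F_integrable that
      by simp
    have eq: "blinfun_apply (integral {0..1} (G x)) =
        (\<lambda>b. integral {0..1} (\<lambda>t. t ^ Suc m * ?F' (t *\<^sub>R x) b))" if "x \<in> ?B" for x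
    proof
      fix b
      have "blinfun_apply (integral {0..1} (G x)) b = integral {0..1} (\<lambda>t. blinfun_apply (G x t) b)"
        using integral_linear[OF G_integrable[OF that] blinfun.bounded_linear_left, of b]
        by (simp add: o_def)
      also have "\<dots> = integral {0..1} (\<lambda>t. t ^ Suc m * ?F' (t *\<^sub>R x) b)"
        by (rule integral_cong) (use fun_cong[OF G[OF that]] in blast)
      finally show "blinfun_apply (integral {0..1} (G x)) b =
          integral {0..1} (\<lambda>t. t ^ Suc m * ?F' (t *\<^sub>R x) b)" .
    qed
    have "((\<lambda>x. integral {0..1} (\<lambda>t. t ^ m * F (t *\<^sub>R x))) has_derivative
        (\<lambda>b. integral {0..1} (\<lambda>t. t ^ Suc m * ?F' (t *\<^sub>R x) b))) (at x)" if "x \<in> ?B" for x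
      using deriv[OF that] unfolding eq[OF that] at_within_open[OF that open_ball] .
    then show ?case
      by (rule Ck_on_SucI[OF open_ball]) (assumption, rule Suc.IH, use Suc.prems in simp)
  qed
qed

section \<open>Closure properties of smooth functions\<close>

lemma Cinf_on_subset: "Cinf_on f S \<Longrightarrow> T \<subseteq> S \<Longrightarrow> open T \<Longrightarrow> Cinf_on f T"
  by (auto simp: Cinf_on_def intro: Ck_on_subset)

lemma Cinf_on_cong: "(\<And>x. x \<in> S \<Longrightarrow> f x = g x) \<Longrightarrow> Cinf_on f S \<longleftrightarrow> Cinf_on g S"
  unfolding Cinf_on_def using Ck_on_cong by metis

lemma Cinf_on_const: "open S \<Longrightarrow> Cinf_on (\<lambda>x. c) S"
  by (simp add: Cinf_on_def Ck_on_const)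

lemma Cinf_on_id:
  assumes "open S"
  shows "Cinf_on (\<lambda>x. x) S"
proof -
  have "Ck_on k (\<lambda>x. x) S" for k
  proof (cases k)
    case (Suc l)
    then show ?thesis
      using Ck_on_SucI[OF assms, where f' = "\<lambda>x b. b" and f = "\<lambda>x. x"]
      by (simp add: Suc Ck_on_const[OF assms] del: Ck_on.simps)
  qed simp
  then show ?thesis by (simp add: Cinf_on_def assms)
qed

lemma Cinf_on_bounded_linear_comp:
  "bounded_linear h \<Longrightarrow> Cinf_on f S \<Longrightarrow> Cinf_on (\<lambda>x. h (f x)) S"
  by (simp add: Cinf_on_def Ck_on_bounded_linear_comp)

lemma Cinf_on_add: "Cinf_on f S \<Longrightarrow> Cinf_on g S \<Longrightarrow> Cinf_on (\<lambda>x. f x + g x) S"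
  by (simp add: Cinf_on_def Ck_on_add)

lemma Cinf_on_mult:
  fixes f g :: "'b::euclidean_space \<Rightarrow> real"
  shows "Cinf_on f S \<Longrightarrow> Cinf_on g S \<Longrightarrow> Cinf_on (\<lambda>x. f x * g x) S"
  by (simp add: Cinf_on_def Ck_on_bilinear[OF bounded_bilinear_mult])

lemma Cinf_on_compose:
  assumes "Cinf_on h S" "Cinf_on f T" "h ` S \<subseteq> T"
  shows "Cinf_on (\<lambda>x. f (h x)) S"
  using assms by (simp add: Cinf_on_def Ck_on_compose[OF _ _ assms(3)])

lemma Cinf_on_has_derivative:
  assumes "Cinf_on f S" "x \<in> S"
  shows "(f has_derivative frechet_derivative f (at x)) (at x)"
  by (rule Ck_on_Suc_has_derivative[of 0]) (use assms in \<open>auto simp: Cinf_on_def simp del: Ck_on.simps\<close>)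

lemma Cinf_on_frechet_derivative:
  assumes "Cinf_on f S"
  shows "Cinf_on (\<lambda>x. frechet_derivative f (at x) v) S"
  using assms Ck_on_frechet_derivative unfolding Cinf_on_def by metis

section \<open>Hadamard's lemma\<close>

lemma frechet_derivative_vec_expand:
  fixes F :: "real ^ 'n::finite \<Rightarrow> real"
  assumes "(F has_derivative F') G"
  shows "F' x = (\<Sum>i\<in>UNIV. x $ i * F' (axis i 1))"
  using linear_eq_sum_Basis[OF has_derivative_linear[OF assms], of x]
  by (simp add: Basis_vec_def sum.UNION_disjoint axis_eq_axis inner_axis)

text \<open>The fundamental theorem of calculus on the segment from \<open>0\<close> to
  \<open>x\<close> writes \<open>F x - F 0\<close> as the integral of the derivative at
  \<open>t *\<^sub>R x\<close> in direction \<open>x\<close>; expanding \<open>x\<close> in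
  coordinates pulls the factors \<open>x $ i\<close> out of the integral.\<close>

lemma Hadamard:
  fixes F :: "real ^ 'n::finite \<Rightarrow> real"
  assumes F: "Cinf_on F (ball 0 r)"
  obtains H where "\<And>i. Cinf_on (H i) (ball 0 r)"
    and "\<And>i. H i 0 = frechet_derivative F (at 0) (axis i 1)"
    and "\<And>x. x \<in> ball 0 r \<Longrightarrow> F x = F 0 + (\<Sum>i\<in>UNIV. x $ i * H i x)"
proof
  let ?F' = "\<lambda>x. frechet_derivative F (at x)" and ?B = "ball (0 :: real ^ 'n) r"
  \<comment> \<open>The factor \<open>t ^ 0\<close> gives the integrand the shape required by
    \<open>Ck_on_radial_integral\<close>.\<close>
  define H where "H i x = integral {0..1} (\<lambda>t. t ^ 0 * ?F' (t *\<^sub>R x) (axis i 1))" for i x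
  show "Cinf_on (H i) ?B" for i
    using Cinf_on_frechet_derivative[OF F, of "axis i 1"] Ck_on_radial_integral
    unfolding Cinf_on_def H_def by blast
  show "H i 0 = ?F' 0 (axis i 1)" for i
    by (simp add: H_def)
  fix x assume x: "x \<in> ?B"
  note scaled = scaleR_mem_ball_0[OF x]
  note F' = Cinf_on_has_derivative[OF F scaled]
  have expand: "?F' (t *\<^sub>R x) x = (\<Sum>i\<in>UNIV. x $ i * ?F' (t *\<^sub>R x) (axis i 1))"
    if "t \<in> {0..1}" for t
    by (rule frechet_derivative_vec_expand[OF F'[OF that]])
  have "((\<lambda>t. F (t *\<^sub>R x)) has_vector_derivative ?F' (t *\<^sub>R x) x) (at t within {0..1})"
    if "t \<in> {0..1}" for t
  proof -
    have "((\<lambda>t. F (t *\<^sub>R x)) has_derivative (\<lambda>s. ?F' (t *\<^sub>R x) (s *\<^sub>R x))) (at t within {0..1})"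
      by (rule has_derivative_compose[of "\<lambda>t. t *\<^sub>R x" _ _ _ F])
         (use F'[OF that] in \<open>auto intro!: derivative_eq_intros\<close>)
    then show ?thesis
      using linear_scale[OF has_derivative_linear[OF F'[OF that]]]
      by (simp add: has_vector_derivative_def)
  qed
  then have "((\<lambda>t. ?F' (t *\<^sub>R x) x) has_integral F (1 *\<^sub>R x) - F (0 *\<^sub>R x)) {0..1}"
    by (intro fundamental_theorem_of_calculus) auto
  then have "F x - F 0 = integral {0..1} (\<lambda>t. ?F' (t *\<^sub>R x) x)"
    by (simp add: integral_unique)
  also have "\<dots> = integral {0..1} (\<lambda>t. \<Sum>i\<in>UNIV. x $ i * ?F' (t *\<^sub>R x) (axis i 1))"
    by (rule integral_cong) (rule expand)
  also have "\<dots> = (\<Sum>i\<in>UNIV. integral {0..1} (\<lambda>t. x $ i * ?F' (t *\<^sub>R x) (axis i 1)))"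
  proof (rule integral_sum)
    fix i :: 'n
    have "continuous_on ?B (\<lambda>x. ?F' x (axis i 1))"
      using Cinf_on_frechet_derivative[OF F] by (metis Cinf_on_def Ck_on.simps(1))
    then have "continuous_on {0..1} (\<lambda>t. ?F' (t *\<^sub>R x) (axis i 1))"
      by (rule continuous_on_compose2) (use scaled in \<open>auto intro!: continuous_intros\<close>)
    then show "(\<lambda>t. x $ i * ?F' (t *\<^sub>R x) (axis i 1)) integrable_on {0..1}"
      by (intro integrable_continuous_real continuous_intros)
  qed simp
  also have "\<dots> = (\<Sum>i\<in>UNIV. x $ i * H i x)"
    by (simp add: H_def)
  finally show "F x = F 0 + (\<Sum>i\<in>UNIV. x $ i * H i x)" by simp
qed

section \<open>Smooth functions on manifolds\<close>

locale smooth_mfd =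
  fixes M :: "'a topology" and A :: "('a, 'n::finite) chart set"
  assumes smooth_manifold: "smooth_manifold M A"
begin

lemma chart_openin: "(U, \<phi>) \<in> A \<Longrightarrow> openin M U"
  using smooth_manifold by (auto simp: smooth_manifold_def)

lemma chart_homeomorphic:
  "(U, \<phi>) \<in> A \<Longrightarrow> homeomorphic_map (subtopology M U) (top_of_set (\<phi> ` U)) \<phi>"
  using smooth_manifold by (auto simp: smooth_manifold_def)

lemma chart_transition:
  "(U, \<phi>) \<in> A \<Longrightarrow> (V, \<kappa>) \<in> A \<Longrightarrow> Cinf_on (\<kappa> \<circ> inv_into U \<phi>) (\<phi> ` (U \<inter> V))"
  using smooth_manifold by (auto simp: smooth_manifold_def)

lemma chart_around:
  assumes "p \<in> topspace M"
  obtains U \<phi> where "(U, \<phi>) \<in> A" "p \<in> U"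
proof -
  have "(\<Union>(U, \<phi>)\<in>A. U) = topspace M"
    using smooth_manifold by (simp add: smooth_manifold_def)
  then show ?thesis
    using assms that by blast
qed

lemma chart_inj: "(U, \<phi>) \<in> A \<Longrightarrow> inj_on \<phi> U"
  using homeomorphic_imp_injective_map[OF chart_homeomorphic] openin_subset[OF chart_openin]
  by (metis topspace_subtopology_subset)

lemma chart_inv: "(U, \<phi>) \<in> A \<Longrightarrow> q \<in> U \<Longrightarrow> inv_into U \<phi> (\<phi> q) = q"
  by (simp add: chart_inj)

lemma chart_image_open:
  assumes "(U, \<phi>) \<in> A" "openin M W"
  shows "open (\<phi> ` (U \<inter> W))"
proof -
  have "openin (top_of_set (\<phi> ` U)) (\<phi> ` (U \<inter> W))"
  proof -
    have "openin (subtopology M U) (U \<inter> W)"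
      using openin_subtopology_Int2[OF assms(2)] .
    then show ?thesis
      using homeomorphic_imp_open_map[OF chart_homeomorphic[OF assms(1)]]
      by (simp add: open_map_def)
  qed
  moreover have "open (\<phi> ` U)"
    using smooth_manifold assms(1) by (auto simp: smooth_manifold_def)
  ultimately show ?thesis
    using openin_open_trans by metis
qed

lemma chart_vimage_open:
  assumes "(U, \<phi>) \<in> A" "open S"
  shows "openin M (U \<inter> \<phi> -` S)"
proof -
  have "openin (subtopology M U) {q \<in> topspace (subtopology M U). \<phi> q \<in> \<phi> ` U \<inter> S}"
    by (rule openin_continuous_map_preimage[OF
          homeomorphic_imp_continuous_map[OF chart_homeomorphic[OF assms(1)]]])
       (use assms(2) in \<open>auto simp: openin_open\<close>)
  moreover have "{q \<in> topspace (subtopology M U). \<phi> q \<in> \<phi> ` U \<inter> S} = U \<inter> \<phi> -` S"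
    using openin_subset[OF chart_openin[OF assms(1)]] by auto
  ultimately show ?thesis
    using openin_trans_full[OF _ chart_openin[OF assms(1)]] by simp
qed

section \<open>Smooth functions on open sets and near a point\<close>

lemma smooth_fun_openin: "smooth_fun M A W f \<Longrightarrow> openin M W"
  by (simp add: smooth_fun_def)

lemma smooth_fun_chart:
  "smooth_fun M A W f \<Longrightarrow> (U, \<phi>) \<in> A \<Longrightarrow> Cinf_on (f \<circ> inv_into U \<phi>) (\<phi> ` (U \<inter> W))"
  by (auto simp: smooth_fun_def)

lemma smooth_funI:
  assumes "openin M W"
    and "\<And>U \<phi>. (U, \<phi>) \<in> A \<Longrightarrow> Cinf_on (f \<circ> inv_into U \<phi>) (\<phi> ` (U \<inter> W))"
  shows "smooth_fun M A W f"
  using assms by (auto simp: smooth_fun_def)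

lemma smooth_fun_subset:
  assumes "smooth_fun M A W f" "openin M V" "V \<subseteq> W"
  shows "smooth_fun M A V f"
  by (intro smooth_funI assms(2) Cinf_on_subset[OF smooth_fun_chart[OF assms(1)]] chart_image_open)
     (use assms(3) in auto)

lemma smooth_fun_cong:
  assumes "smooth_fun M A W f" "\<And>q. q \<in> W \<Longrightarrow> f q = h q"
  shows "smooth_fun M A W h"
proof (rule smooth_funI[OF smooth_fun_openin[OF assms(1)]])
  fix U \<phi> assume c: "(U, \<phi>) \<in> A"
  show "Cinf_on (h \<circ> inv_into U \<phi>) (\<phi> ` (U \<inter> W))"
    using smooth_fun_chart[OF assms(1) c]
    by (rule Cinf_on_cong[THEN iffD1, rotated]) (auto simp: chart_inv[OF c] assms(2))
qed

lemma smooth_fun_const: "openin M W \<Longrightarrow> smooth_fun M A W (\<lambda>q. c)"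
  by (rule smooth_funI) (simp_all add: o_def Cinf_on_const chart_image_open)

lemma smooth_fun_add:
  assumes "smooth_fun M A W f" "smooth_fun M A W h"
  shows "smooth_fun M A W (\<lambda>q. f q + h q)"
  using assms Cinf_on_add[OF smooth_fun_chart[OF assms(1)] smooth_fun_chart[OF assms(2)]]
  by (intro smooth_funI smooth_fun_openin[OF assms(1)]) (simp add: o_def)

lemma smooth_fun_mult:
  assumes "smooth_fun M A W f" "smooth_fun M A W h"
  shows "smooth_fun M A W (\<lambda>q. f q * h q)"
  using assms Cinf_on_mult[OF smooth_fun_chart[OF assms(1)] smooth_fun_chart[OF assms(2)]]
  by (intro smooth_funI smooth_fun_openin[OF assms(1)]) (simp add: o_def)

text \<open>Seen in another chart \<open>\<kappa>\<close>, the function is \<open>h\<close> after a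
  transition map, and transition maps are smooth.\<close>

lemma smooth_fun_comp_chart:
  assumes c: "(U, \<phi>) \<in> A" and h: "Cinf_on h S" and W: "openin M W" "W \<subseteq> U" "\<phi> ` W \<subseteq> S"
  shows "smooth_fun M A W (\<lambda>q. h (\<phi> q))"
proof (rule smooth_funI[OF W(1)])
  fix V \<kappa> assume c': "(V, \<kappa>) \<in> A"
  have "Cinf_on (\<phi> \<circ> inv_into V \<kappa>) (\<kappa> ` (V \<inter> W))"
    by (rule Cinf_on_subset[OF chart_transition[OF c' c]])
       (use W chart_image_open[OF c'] in auto)
  then show "Cinf_on ((\<lambda>q. h (\<phi> q)) \<circ> inv_into V \<kappa>) (\<kappa> ` (V \<inter> W))"
    unfolding o_def by (rule Cinf_on_compose[OF _ h]) (use W chart_inv[OF c'] in auto)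
qed

lemma smooth_fun_coord:
  assumes "(U, \<phi>) \<in> A"
  shows "smooth_fun M A U (\<lambda>q. \<phi> q $ i)"
  using smooth_fun_comp_chart[OF assms Cinf_on_bounded_linear_comp[OF bounded_linear_vec_nth
        Cinf_on_id[OF open_UNIV]] chart_openin[OF assms]]
  by simp

lemma smooth_nearI: "smooth_fun M A W f \<Longrightarrow> p \<in> W \<Longrightarrow> smooth_near M A p f"
  by (auto simp: smooth_near_def)

lemma smooth_near_obtain:
  assumes "smooth_near M A p f" "smooth_near M A p h"
  obtains W where "p \<in> W" "smooth_fun M A W f" "smooth_fun M A W h"
proof -
  obtain W W' where "p \<in> W" "smooth_fun M A W f" "p \<in> W'" "smooth_fun M A W' h"
    using assms by (auto simp: smooth_near_def)
  then show ?thesis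
    using that[of "W \<inter> W'"] smooth_fun_subset smooth_fun_openin by (meson IntI inf_le1 inf_le2 openin_Int)
qed

lemma smooth_near_cong:
  assumes "smooth_near M A p f" "openin M W" "p \<in> W" "\<And>q. q \<in> W \<Longrightarrow> f q = h q"
  shows "smooth_near M A p h"
proof -
  obtain V where V: "p \<in> V" "smooth_fun M A V f"
    using assms(1) by (auto simp: smooth_near_def)
  have "openin M (V \<inter> W)"
    using V smooth_fun_openin assms(2) by blast
  then have "smooth_fun M A (V \<inter> W) h"
    using smooth_fun_cong[OF smooth_fun_subset[OF V(2)]] assms(4) by auto
  then show ?thesis using smooth_nearI V assms(3) by blast
qed

lemma smooth_near_topspace: "smooth_near M A p f \<Longrightarrow> p \<in> topspace M"
  using smooth_fun_openin openin_subset by (fastforce simp: smooth_near_def)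

lemma smooth_near_const: "p \<in> topspace M \<Longrightarrow> smooth_near M A p (\<lambda>q. c)"
  using smooth_nearI smooth_fun_const by blast

lemma smooth_near_add:
  "smooth_near M A p f \<Longrightarrow> smooth_near M A p h \<Longrightarrow> smooth_near M A p (\<lambda>q. f q + h q)"
  by (erule (1) smooth_near_obtain) (rule smooth_nearI[OF smooth_fun_add])

lemma smooth_near_mult:
  "smooth_near M A p f \<Longrightarrow> smooth_near M A p h \<Longrightarrow> smooth_near M A p (\<lambda>q. f q * h q)"
  by (erule (1) smooth_near_obtain) (rule smooth_nearI[OF smooth_fun_mult])

lemma smooth_near_sum:
  "p \<in> topspace M \<Longrightarrow> (\<And>i. i \<in> I \<Longrightarrow> smooth_near M A p (f i)) \<Longrightarrow>
    smooth_near M A p (\<lambda>q. \<Sum>i\<in>I. f i q)"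
  by (induction I rule: infinite_finite_induct) (simp_all add: smooth_near_const smooth_near_add)

section \<open>Tangent vectors\<close>

lemma tangent_not_smooth: "v \<in> tangent_space M A p \<Longrightarrow> \<not> smooth_near M A p f \<Longrightarrow> v f = 0"
  by (simp add: tangent_space_def)

lemma tangent_add:
  "v \<in> tangent_space M A p \<Longrightarrow> smooth_near M A p f \<Longrightarrow> smooth_near M A p h \<Longrightarrow>
    v (\<lambda>q. f q + h q) = v f + v h"
  by (simp add: tangent_space_def)

lemma tangent_mult:
  "v \<in> tangent_space M A p \<Longrightarrow> smooth_near M A p f \<Longrightarrow> smooth_near M A p h \<Longrightarrow>
    v (\<lambda>q. f q * h q) = f p * v h + h p * v f"
  by (simp add: tangent_space_def)

lemma tangent_scale:
  "v \<in> tangent_space M A p \<Longrightarrow> smooth_near M A p f \<Longrightarrow> v (\<lambda>q. c * f q) = c * v f"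
  by (simp add: tangent_space_def)

lemma tangent_const:
  assumes "v \<in> tangent_space M A p" "p \<in> topspace M"
  shows "v (\<lambda>q. c) = 0"
proof -
  have "v (\<lambda>q. 1) = 0"
    using tangent_mult[OF assms(1) smooth_near_const smooth_near_const, of 1 1] assms(2) by simp
  moreover have "v (\<lambda>q. c * 1) = c * v (\<lambda>q. 1)"
    by (rule tangent_scale[OF assms(1) smooth_near_const[OF assms(2)]])
  ultimately show ?thesis by simp
qed

lemma tangent_sum:
  assumes "v \<in> tangent_space M A p" "p \<in> topspace M"
  shows "(\<And>i. i \<in> I \<Longrightarrow> smooth_near M A p (f i)) \<Longrightarrow> v (\<lambda>q. \<Sum>i\<in>I. f i q) = (\<Sum>i\<in>I. v (f i))"
  by (induction I rule: infinite_finite_induct)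
     (simp_all add: tangent_const[OF assms] tangent_add[OF assms(1)] smooth_near_sum assms(2))

text \<open>Values of functions away from \<open>p\<close> are unconstrained, so the indicator function of an open
  neighbourhood of \<open>p\<close> is smooth near \<open>p\<close> and replaces a bump function.\<close>

lemma smooth_fun_indicator:
  assumes "openin M W"
  shows "smooth_fun M A W (\<lambda>q. if q \<in> W then 1 else 0)"
  by (rule smooth_fun_cong[OF smooth_fun_const[OF assms, of 1]]) simp

lemma tangent_local:
  assumes v: "v \<in> tangent_space M A p"
    and W: "openin M W" "p \<in> W" "\<And>q. q \<in> W \<Longrightarrow> f q = h q"
  shows "v f = v h"
proof (cases "smooth_near M A p f")
  case True
  let ?i = "\<lambda>q. if q \<in> W then 1 else 0 :: real"
  have i: "smooth_near M A p ?i"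
    using smooth_nearI[OF smooth_fun_indicator] W by blast
  have h: "smooth_near M A p h"
    using smooth_near_cong[OF True W(1,2)] W(3) by blast
  \<comment> \<open>The two products agree as total functions. As \<open>?i p = 1\<close> and
    \<open>f p = h p\<close>, the product rule leaves \<open>v f = v h\<close>.\<close>
  have "(\<lambda>q. ?i q * f q) = (\<lambda>q. ?i q * h q)"
    using W(3) by auto
  then have "?i p * v f + f p * v ?i = ?i p * v h + h p * v ?i"
    using tangent_mult[OF v i True] tangent_mult[OF v i h] by simp
  then show ?thesis using W by simp
next
  case False
  \<comment> \<open>Smoothness near \<open>p\<close> is itself local, so both functions receive the
    default value \<open>0\<close>.\<close>
  then have "\<not> smooth_near M A p h"
    using smooth_near_cong[OF _ W(1,2), of h f] W(3) by auto
  then show ?thesis using tangent_not_smooth[OF v] False by simp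
qed

lemma tadd_tangent:
  "u \<in> tangent_space M A p \<Longrightarrow> v \<in> tangent_space M A p \<Longrightarrow> tadd u v \<in> tangent_space M A p"
  by (auto simp: tangent_space_def tadd_def algebra_simps)

lemma tscale_tangent: "v \<in> tangent_space M A p \<Longrightarrow> tscale c v \<in> tangent_space M A p"
  by (auto simp: tangent_space_def tscale_def algebra_simps)

lemma tdiff_eq: "tdiff u v = tadd u (tscale (-1) v)"
  by (simp add: tdiff_def tadd_def tscale_def)

lemma tdiff_tangent:
  "u \<in> tangent_space M A p \<Longrightarrow> v \<in> tangent_space M A p \<Longrightarrow> tdiff u v \<in> tangent_space M A p"
  by (simp add: tdiff_eq tadd_tangent tscale_tangent)

section \<open>Vector fields\<close>

lemma vector_field_openin: "vector_field M A W Y \<Longrightarrow> openin M W"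
  by (simp add: vector_field_def)

lemma vector_field_tangent: "vector_field M A W Y \<Longrightarrow> q \<in> W \<Longrightarrow> Y q \<in> tangent_space M A q"
  by (simp add: vector_field_def)

lemma vector_field_smooth:
  "vector_field M A W Y \<Longrightarrow> smooth_fun M A V f \<Longrightarrow> V \<subseteq> W \<Longrightarrow> smooth_fun M A V (\<lambda>q. Y q f)"
  by (simp add: vector_field_def)

lemma vector_field_subset:
  "vector_field M A W Y \<Longrightarrow> openin M V \<Longrightarrow> V \<subseteq> W \<Longrightarrow> vector_field M A V Y"
  by (auto simp: vector_field_def)

lemma vector_field_cong:
  assumes "vector_field M A W Y" "\<And>q. q \<in> W \<Longrightarrow> Y q = Z q"
  shows "vector_field M A W Z"
proof -
  have "smooth_fun M A V (\<lambda>q. Z q f)" if "V \<subseteq> W" "smooth_fun M A V f" for V f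
    by (rule smooth_fun_cong[OF vector_field_smooth[OF assms(1) that(2,1)]])
       (use assms(2) that in auto)
  then show ?thesis
    using assms by (simp add: vector_field_def)
qed

end

section \<open>Coordinate fields\<close>

locale smooth_chart = smooth_mfd M A
  for M :: "'a topology" and A :: "('a, 'n::finite) chart set" +
  fixes U :: "'a set" and \<phi> :: "'a \<Rightarrow> real ^ 'n"
  assumes chart: "(U, \<phi>) \<in> A"
begin

text \<open>The coordinate field with constant components \<open>x\<close>. The value
  \<open>0\<close> off the functions smooth near \<open>q\<close> is the convention of
  \<open>tangent_space\<close>; it makes equality with an abstract derivation possible.\<close>

definition coord_vec :: "real ^ 'n \<Rightarrow> 'a \<Rightarrow> 'a tangent" where
  "coord_vec x q f =
     (if smooth_near M A q f then frechet_derivative (f \<circ> inv_into U \<phi>) (at (\<phi> q)) x else 0)"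

lemma smooth_near_has_derivative:
  assumes "smooth_near M A q f" "q \<in> U"
  shows "((f \<circ> inv_into U \<phi>) has_derivative
      frechet_derivative (f \<circ> inv_into U \<phi>) (at (\<phi> q))) (at (\<phi> q))"
proof -
  obtain W where "q \<in> W" "smooth_fun M A W f"
    using assms(1) by (auto simp: smooth_near_def)
  then show ?thesis
    using Cinf_on_has_derivative[OF smooth_fun_chart[OF _ chart]] assms(2) by blast
qed

lemma coord_vec_eqI:
  assumes "smooth_near M A q f" "((f \<circ> inv_into U \<phi>) has_derivative f') (at (\<phi> q))"
  shows "coord_vec x q f = f' x"
  using assms frechet_derivative_at[OF assms(2)] by (simp add: coord_vec_def)

lemma coord_vec_tangent:
  assumes "q \<in> U"
  shows "coord_vec x q \<in> tangent_space M A q"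
proof -
  note d = smooth_near_has_derivative[OF _ assms]
  have 1: "coord_vec x q (\<lambda>r. f r + h r) = coord_vec x q f + coord_vec x q h"
    if f: "smooth_near M A q f" and h: "smooth_near M A q h" for f h
    using coord_vec_eqI[OF smooth_near_add[OF f h], where x = x] has_derivative_add[OF d[OF f] d[OF h]] f h
    by (simp add: o_def coord_vec_def)
  have 2: "coord_vec x q (\<lambda>r. f r * h r) = f q * coord_vec x q h + h q * coord_vec x q f"
    if f: "smooth_near M A q f" and h: "smooth_near M A q h" for f h
    using coord_vec_eqI[OF smooth_near_mult[OF f h], where x = x] has_derivative_mult[OF d[OF f] d[OF h]] f h
    by (simp add: o_def coord_vec_def chart_inv[OF chart assms])
  have 3: "coord_vec x q (\<lambda>r. c * f r) = c * coord_vec x q f"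
    if f: "smooth_near M A q f" for f c
  proof -
    have "smooth_near M A q (\<lambda>r. c * f r)"
      by (intro smooth_near_mult smooth_near_const smooth_near_topspace[OF f] f)
    then show ?thesis
      using coord_vec_eqI[where x = x] has_derivative_mult_right[OF d[OF f], of c] f
      by (simp add: o_def coord_vec_def)
  qed
  show ?thesis
    using 1 2 3 by (auto simp: tangent_space_def) (simp add: coord_vec_def)
qed

lemma coord_vec_coord:
  assumes "q \<in> U"
  shows "coord_vec x q (\<lambda>r. \<phi> r $ i) = x $ i"
proof (rule coord_vec_eqI)
  show "smooth_near M A q (\<lambda>r. \<phi> r $ i)"
    using smooth_nearI smooth_fun_coord[OF chart] assms by blast
  have "open (\<phi> ` U)"
    using chart_image_open[OF chart chart_openin[OF chart]] by simp
  then show "((\<lambda>r. \<phi> r $ i) \<circ> inv_into U \<phi> has_derivative (\<lambda>x. x $ i)) (at (\<phi> q))"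
    by (rule has_derivative_transform_within_open[OF
          bounded_linear_imp_has_derivative[OF bounded_linear_vec_nth]])
       (use assms in \<open>auto simp: chart_inv[OF chart]\<close>)
qed

lemma vector_field_coord_vec: "vector_field M A U (coord_vec x)"
  unfolding vector_field_def
proof (intro conjI ballI allI impI)
  show "openin M U" using chart_openin[OF chart] .
  show "coord_vec x q \<in> tangent_space M A q" if "q \<in> U" for q
    using coord_vec_tangent[OF that] .
  fix V f assume V: "V \<subseteq> U" and f: "smooth_fun M A V f"
  have "smooth_fun M A V (\<lambda>q. frechet_derivative (f \<circ> inv_into U \<phi>) (at (\<phi> q)) x)"
    by (rule smooth_fun_comp_chart[OF chart Cinf_on_frechet_derivative[OF smooth_fun_chart[OF f chart]]
          smooth_fun_openin[OF f] V]) (use V in auto)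
  then show "smooth_fun M A V (\<lambda>q. coord_vec x q f)"
    by (rule smooth_fun_cong) (use smooth_nearI[OF f] in \<open>simp add: coord_vec_def\<close>)
qed

text \<open>By Hadamard's lemma \<open>f\<close> is, near \<open>p\<close>, a constant plus a sum of
  centred coordinates times smooth functions, so a derivation is determined by its values on the
  coordinates. This bounds the dimension of the tangent space by \<open>CARD('n)\<close>.\<close>

lemma tangent_eq_coord_vec:
  assumes p: "p \<in> U" and v: "v \<in> tangent_space M A p"
  shows "v = coord_vec (\<chi> i. v (\<lambda>q. \<phi> q $ i)) p"
proof
  fix f
  show "v f = coord_vec (\<chi> i. v (\<lambda>q. \<phi> q $ i)) p f"
  proof (cases "smooth_near M A p f")
    case True
    then obtain W where W: "p \<in> W" "smooth_fun M A W f"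
      by (auto simp: smooth_near_def)
    \<comment> \<open>\<open>f\<close> in the chart, translated so that \<open>p\<close> corresponds
      to the origin of Hadamard's lemma.\<close>
    define F where "F y = (f \<circ> inv_into U \<phi>) (\<phi> p + y)" for y
    have pM: "p \<in> topspace M"
      using smooth_near_topspace[OF True] .
    have S: "open (\<phi> ` (U \<inter> W))" "\<phi> p \<in> \<phi> ` (U \<inter> W)"
      using chart_image_open[OF chart smooth_fun_openin[OF W(2)]] p W by auto
    then obtain r where r: "r > 0" "ball (\<phi> p) r \<subseteq> \<phi> ` (U \<inter> W)"
      by (meson open_contains_ball)
    have sub: "(\<lambda>y. \<phi> p + y) ` ball 0 r \<subseteq> \<phi> ` (U \<inter> W)"
      using r(2) by (auto simp: dist_norm)
    have "Cinf_on F (ball 0 r)"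
      unfolding F_def using smooth_fun_chart[OF W(2) chart] sub
      by (rule Cinf_on_compose[rotated]) (intro Cinf_on_add Cinf_on_const Cinf_on_id open_ball)
    then obtain H where H: "\<And>i. Cinf_on (H i) (ball 0 r)"
      "\<And>i. H i 0 = frechet_derivative F (at 0) (axis i 1)"
      "\<And>y. y \<in> ball 0 r \<Longrightarrow> F y = F 0 + (\<Sum>i\<in>UNIV. y $ i * H i y)"
      using Hadamard by blast
    define h where "h i = (\<lambda>q. H i (\<phi> q - \<phi> p))" for i
    \<comment> \<open>The expansion of \<open>f\<close> is valid only on this neighbourhood;
      \<open>tangent_local\<close> makes that sufficient.\<close>
    define V where "V = U \<inter> \<phi> -` ball (\<phi> p) r"
    have V: "openin M V" "V \<subseteq> U" "p \<in> V"
      unfolding V_def using chart_vimage_open[OF chart open_ball] p r(1) by auto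
    have "Cinf_on (\<lambda>y. y + - \<phi> p) (ball (\<phi> p) r)"
      by (intro Cinf_on_add Cinf_on_const Cinf_on_id open_ball)
    then have "Cinf_on (\<lambda>y. H i (y + - \<phi> p)) (ball (\<phi> p) r)" for i
      by (rule Cinf_on_compose[OF _ H(1)]) (auto simp: dist_norm norm_minus_commute)
    then have h: "smooth_near M A p (h i)" for i
      using smooth_nearI[OF smooth_fun_comp_chart[OF chart _ V(1,2)], of "\<lambda>y. H i (y + - \<phi> p)" "ball (\<phi> p) r" p] V
      by (auto simp: h_def V_def)
    have coord: "smooth_near M A p (\<lambda>q. \<phi> q $ i)" for i
      using smooth_nearI[OF smooth_fun_coord[OF chart] p] .
    have coord': "smooth_near M A p (\<lambda>q. \<phi> q $ i + - \<phi> p $ i)" for i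
      by (intro smooth_near_add coord smooth_near_const pM)
    note const = tangent_const[OF v pM]
    have "v f = v (\<lambda>q. f p + (\<Sum>i\<in>UNIV. (\<phi> q $ i + - \<phi> p $ i) * h i q))"
    proof (rule tangent_local[OF v V(1,3)])
      fix q assume "q \<in> V"
      then have "\<phi> q - \<phi> p \<in> ball 0 r" "q \<in> U"
        by (auto simp: V_def dist_norm norm_minus_commute)
      then show "f q = f p + (\<Sum>i\<in>UNIV. (\<phi> q $ i + - \<phi> p $ i) * h i q)"
        using H(3)[of "\<phi> q - \<phi> p"] by (simp add: F_def h_def chart_inv[OF chart] p)
    qed
    also have "\<dots> = v (\<lambda>q. \<Sum>i\<in>UNIV. (\<phi> q $ i + - \<phi> p $ i) * h i q)"
      by (subst tangent_add[OF v smooth_near_const[OF pM]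
            smooth_near_sum[OF pM smooth_near_mult[OF coord' h]]]) (simp add: const)
    also have "\<dots> = (\<Sum>i\<in>UNIV. v (\<lambda>q. (\<phi> q $ i + - \<phi> p $ i) * h i q))"
      by (rule tangent_sum[OF v pM smooth_near_mult[OF coord' h]])
    \<comment> \<open>The centred coordinates vanish at \<open>p\<close>, so one of the two terms of
      the product rule disappears.\<close>
    also have "\<dots> = (\<Sum>i\<in>UNIV. h i p * v (\<lambda>q. \<phi> q $ i + - \<phi> p $ i))"
      by (rule sum.cong[OF refl]) (subst tangent_mult[OF v coord' h], simp)
    also have "\<dots> = (\<Sum>i\<in>UNIV. v (\<lambda>q. \<phi> q $ i) * h i p)"
      by (rule sum.cong[OF refl]) (subst tangent_add[OF v coord smooth_near_const[OF pM]], simp add: const)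
    also have "\<dots> = coord_vec (\<chi> i. v (\<lambda>q. \<phi> q $ i)) p f"
    proof -
      note d = smooth_near_has_derivative[OF True p]
      have "(F has_derivative frechet_derivative (f \<circ> inv_into U \<phi>) (at (\<phi> p))) (at 0)"
        unfolding F_def
        by (rule has_derivative_compose[of "\<lambda>y. \<phi> p + y" "\<lambda>y. y" 0 UNIV "f \<circ> inv_into U \<phi>"])
           (use d in \<open>auto intro!: derivative_eq_intros\<close>)
      from frechet_derivative_at[OF this] show ?thesis
        using True frechet_derivative_vec_expand[OF d, of "\<chi> i. v (\<lambda>q. \<phi> q $ i)"]
        by (simp add: coord_vec_def h_def H(2))
    qed
    finally show ?thesis .
  next
    case False
    then show ?thesis using tangent_not_smooth[OF v] by (simp add: coord_vec_def)
  qed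
qed

lemma coord_vec_add: "q \<in> U \<Longrightarrow> coord_vec (x + y) q = tadd (coord_vec x q) (coord_vec y q)"
  using linear_add[OF has_derivative_linear[OF smooth_near_has_derivative]]
  by (auto simp: coord_vec_def tadd_def)

lemma coord_vec_scale: "q \<in> U \<Longrightarrow> coord_vec (c *\<^sub>R x) q = tscale c (coord_vec x q)"
  using linear_scale[OF has_derivative_linear[OF smooth_near_has_derivative]]
  by (auto simp: coord_vec_def tscale_def)

lemma coord_vec_sum:
  "q \<in> U \<Longrightarrow> coord_vec (\<Sum>i\<in>I. x i) q f = (\<Sum>i\<in>I. coord_vec (x i) q f)"
  using linear_sum[OF has_derivative_linear[OF smooth_near_has_derivative]]
  by (auto simp: coord_vec_def)

lemma coord_vec_inj: "q \<in> U \<Longrightarrow> coord_vec x q = coord_vec y q \<Longrightarrow> x = y"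
  by (metis coord_vec_coord vec_eq_iff)

end

context smooth_mfd
begin

text \<open>A coordinate field with constant components already extends \<open>v\<close>. Since
  extensions are only asked to be smooth near \<open>p\<close>, no cut-off is involved.\<close>

lemma extension_vector_field:
  assumes "p \<in> topspace M" "v \<in> tangent_space M A p"
  obtains W where "p \<in> W" "vector_field M A W (extension M A p v)" "extension M A p v p = v"
proof -
  obtain U \<phi> where c: "(U, \<phi>) \<in> A" "p \<in> U"
    using chart_around[OF assms(1)] .
  interpret smooth_chart M A U \<phi> by unfold_locales (rule c)
  have "\<exists>V W. p \<in> W \<and> vector_field M A W V \<and> V p = v"
    using vector_field_coord_vec tangent_eq_coord_vec[OF c(2) assms(2)] c(2) by metis
  from someI_ex[OF this] show ?thesis
    using that unfolding extension_def by blast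
qed

end

section \<open>Orthonormal bases\<close>

text \<open>Gram-Schmidt is carried out on coordinate vectors, where dimension and independence are
  available; the metric at a point is later pulled back to such a form.\<close>

locale pos_def_form =
  fixes B :: "'v::euclidean_space \<Rightarrow> 'v \<Rightarrow> real"
  assumes bilinear: "bilinear B"
    and sym: "B x y = B y x"
    and pos: "x \<noteq> 0 \<Longrightarrow> B x x > 0"
begin

definition orthonormal :: "'v set \<Rightarrow> bool" where
  "orthonormal S \<longleftrightarrow> finite S \<and> (\<forall>s\<in>S. \<forall>t\<in>S. B s t = (if s = t then 1 else 0))"

lemma orthonormal_sum:
  assumes "orthonormal S" "t \<in> S"
  shows "B (\<Sum>s\<in>S. c s *\<^sub>R s) t = c t"
proof -
  have "B (\<Sum>s\<in>S. c s *\<^sub>R s) t = (\<Sum>s\<in>S. c s * B s t)"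
    using bilinear by (simp add: bilinear_def linear_sum[of "\<lambda>x. B x t"] linear_scale[of "\<lambda>x. B x t"])
  also have "\<dots> = (\<Sum>s\<in>S. if s = t then c s else 0)"
    using assms by (intro sum.cong) (auto simp: orthonormal_def)
  finally show ?thesis using assms by (simp add: orthonormal_def)
qed

lemma orthonormal_independent:
  assumes "orthonormal S"
  shows "independent S"
proof (rule independent_if_scalars_zero)
  show "finite S" using assms by (simp add: orthonormal_def)
  fix c t assume "(\<Sum>s\<in>S. c s *\<^sub>R s) = 0" "t \<in> S"
  then show "c t = 0"
    using orthonormal_sum[OF assms, of t c] bilinear_lzero[OF bilinear] by simp
qed

text \<open>One Gram-Schmidt step: the residual of \<open>x\<close> is nonzero and orthogonal to
  \<open>S\<close>, and is then normalised. It yields both the existence of bases and, by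
  contradiction, the expansion in them.\<close>

lemma orthonormal_extend:
  assumes S: "orthonormal S" and x: "x \<noteq> (\<Sum>s\<in>S. B x s *\<^sub>R s)"
  obtains e where "e \<notin> S" "orthonormal (insert e S)"
proof -
  define v where "v = x - (\<Sum>s\<in>S. B x s *\<^sub>R s)"
  have "v \<noteq> 0" using x by (simp add: v_def)
  have vt: "B v t = 0" if "t \<in> S" for t
    using orthonormal_sum[OF S that, of "\<lambda>s. B x s"] bilinear_lsub[OF bilinear] by (simp add: v_def)
  define e where "e = (1 / sqrt (B v v)) *\<^sub>R v"
  have et: "B e t = 0" if "t \<in> S" for t
    using vt[OF that] by (simp add: e_def bilinear_lmul[OF bilinear])
  then have te: "B t e = 0" if "t \<in> S" for t
    using sym[of t e] that by simp
  have ee: "B e e = 1"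
    using pos[OF \<open>v \<noteq> 0\<close>]
    by (simp add: e_def bilinear_lmul[OF bilinear] bilinear_rmul[OF bilinear])
  have "e \<notin> S" using et[of e] ee by auto
  moreover have "orthonormal (insert e S)"
    using S et ee te \<open>e \<notin> S\<close> by (auto simp: orthonormal_def)
  ultimately show ?thesis using that by blast
qed

lemma orthonormal_exists:
  "k \<le> DIM('v) \<Longrightarrow> \<exists>S. orthonormal S \<and> card S = k"
proof (induction k)
  case 0
  have "orthonormal {}" by (simp add: orthonormal_def)
  then show ?case by (intro exI[of _ "{}"]) simp
next
  case (Suc k)
  then obtain S where S: "orthonormal S" "card S = k" by auto
  have fin: "finite S" using S by (simp add: orthonormal_def)
  have "span S \<noteq> UNIV"
    using dim_le_card'[OF fin] S(2) Suc.prems dim_span[of S] by (auto simp del: dim_span)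
  then obtain x where "x \<notin> span S" by auto
  moreover have "(\<Sum>s\<in>S. B x s *\<^sub>R s) \<in> span S"
    by (intro span_sum span_scale span_base)
  ultimately have "x \<noteq> (\<Sum>s\<in>S. B x s *\<^sub>R s)" by metis
  from orthonormal_extend[OF S(1) this] show ?case
    using S(2) fin card_insert_disjoint by metis
qed

text \<open>A vector violating the expansion would enlarge \<open>S\<close> to an independent set
  with more than \<open>DIM('v)\<close> elements.\<close>

lemma orthonormal_expand:
  assumes "orthonormal S" "card S = DIM('v)"
  shows "x = (\<Sum>s\<in>S. B x s *\<^sub>R s)"
proof (rule ccontr)
  assume "x \<noteq> (\<Sum>s\<in>S. B x s *\<^sub>R s)"
  then obtain e where e: "e \<notin> S" "orthonormal (insert e S)"
    using orthonormal_extend assms(1) by blast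
  then have "card (insert e S) \<le> DIM('v)"
    using independent_card_le[OF orthonormal_independent] by blast
  then show False
    using e assms by (simp add: orthonormal_def)
qed

end

section \<open>The Levi-Civita connection\<close>

locale riemannian_mfd = smooth_mfd M A
  for M :: "'a topology" and A :: "('a, 'n::finite) chart set" +
  fixes g :: "'a \<Rightarrow> 'a tangent \<Rightarrow> 'a tangent \<Rightarrow> real"
    and D :: "'a \<Rightarrow> 'a tangent \<Rightarrow> ('a \<Rightarrow> 'a tangent) \<Rightarrow> 'a tangent"
  assumes metric: "riemannian_metric M A g" and conn: "levi_civita M A g D"
begin

lemma metric_sym:
  "p \<in> topspace M \<Longrightarrow> u \<in> tangent_space M A p \<Longrightarrow> v \<in> tangent_space M A p \<Longrightarrow> g p u v = g p v u"
  using metric unfolding riemannian_metric_def by blast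

lemma metric_pos: "p \<in> topspace M \<Longrightarrow> u \<in> tangent_space M A p \<Longrightarrow> u \<noteq> tzero \<Longrightarrow> g p u u > 0"
  using metric unfolding riemannian_metric_def by blast

lemma metric_add_left:
  "p \<in> topspace M \<Longrightarrow> u \<in> tangent_space M A p \<Longrightarrow> v \<in> tangent_space M A p \<Longrightarrow>
    w \<in> tangent_space M A p \<Longrightarrow> g p (tadd u v) w = g p u w + g p v w"
  using metric unfolding riemannian_metric_def by blast

lemma metric_scale_left:
  "p \<in> topspace M \<Longrightarrow> u \<in> tangent_space M A p \<Longrightarrow> v \<in> tangent_space M A p \<Longrightarrow>
    g p (tscale c u) v = c * g p u v"
  using metric unfolding riemannian_metric_def by blast

lemma metric_add_right:
  "p \<in> topspace M \<Longrightarrow> u \<in> tangent_space M A p \<Longrightarrow> v \<in> tangent_space M A p \<Longrightarrow>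
    w \<in> tangent_space M A p \<Longrightarrow> g p w (tadd u v) = g p w u + g p w v"
  by (simp add: metric_sym[of p w] metric_add_left tadd_tangent)

lemma metric_scale_right:
  "p \<in> topspace M \<Longrightarrow> u \<in> tangent_space M A p \<Longrightarrow> v \<in> tangent_space M A p \<Longrightarrow>
    g p v (tscale c u) = c * g p v u"
  by (simp add: metric_sym[of p v] metric_scale_left tscale_tangent)

lemma metric_diff_left:
  "p \<in> topspace M \<Longrightarrow> u \<in> tangent_space M A p \<Longrightarrow> v \<in> tangent_space M A p \<Longrightarrow>
    w \<in> tangent_space M A p \<Longrightarrow> g p (tdiff u v) w = g p u w - g p v w"
  by (simp add: tdiff_eq metric_add_left metric_scale_left tscale_tangent)

lemma metric_smooth:
  "vector_field M A W Y \<Longrightarrow> vector_field M A W Z \<Longrightarrow> smooth_fun M A W (\<lambda>q. g q (Y q) (Z q))"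
  using metric by (simp add: riemannian_metric_def)

lemma vector_field_topspace: "vector_field M A W Y \<Longrightarrow> q \<in> W \<Longrightarrow> q \<in> topspace M"
  using openin_subset vector_field_openin by blast

lemma affine: "affine_connection M A D"
  using conn by (simp add: levi_civita_def)

lemma conn_tangent:
  "vector_field M A W Y \<Longrightarrow> p \<in> W \<Longrightarrow> u \<in> tangent_space M A p \<Longrightarrow> D p u Y \<in> tangent_space M A p"
  using affine unfolding affine_connection_def by blast

lemma conn_leibniz:
  "vector_field M A W Y \<Longrightarrow> p \<in> W \<Longrightarrow> u \<in> tangent_space M A p \<Longrightarrow> smooth_fun M A W f \<Longrightarrow>
    D p u (\<lambda>q. tscale (f q) (Y q)) = tadd (tscale (u f) (Y p)) (tscale (f p) (D p u Y))"
  using affine unfolding affine_connection_def by blast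

lemma conn_smooth:
  "vector_field M A W Y \<Longrightarrow> vector_field M A W V \<Longrightarrow> vector_field M A W (\<lambda>q. D q (V q) Y)"
  using affine unfolding affine_connection_def by blast

lemma conn_torsion_free:
  "vector_field M A W Y \<Longrightarrow> vector_field M A W Z \<Longrightarrow> p \<in> W \<Longrightarrow>
    lie_bracket M A Y Z p = tdiff (D p (Y p) Z) (D p (Z p) Y)"
  using conn unfolding levi_civita_def by metis

lemma conn_metric:
  "vector_field M A W Y \<Longrightarrow> vector_field M A W Z \<Longrightarrow> p \<in> W \<Longrightarrow> v \<in> tangent_space M A p \<Longrightarrow>
    v (\<lambda>q. g q (Y q) (Z q)) = g p (D p v Y) (Z p) + g p (Y p) (D p v Z)"
  using conn unfolding levi_civita_def by metis

text \<open>The axioms apply \<open>D\<close> to total functions, so values outside \<open>W\<close>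
  could matter a priori. Multiplied by the indicator of \<open>W\<close>, the two fields become the
  same function; the Leibniz rule then strips the indicator, because
  \<open>Y p = Z p\<close>.\<close>

lemma conn_local:
  assumes Y: "vector_field M A W Y" and p: "p \<in> W" "u \<in> tangent_space M A p"
    and eq: "\<And>q. q \<in> W \<Longrightarrow> Y q = Z q"
  shows "D p u Y = D p u Z"
proof -
  have Z: "vector_field M A W Z" using vector_field_cong[OF Y eq] .
  let ?i = "\<lambda>q. if q \<in> W then 1 else 0 :: real"
  have i: "smooth_fun M A W ?i"
    using smooth_fun_indicator[OF vector_field_openin[OF Y]] .
  have "(\<lambda>q. tscale (?i q) (Y q)) = (\<lambda>q. tscale (?i q) (Z q))"
    using eq by (auto simp: tscale_def fun_eq_iff)
  then have "tadd (tscale (u ?i) (Y p)) (tscale (?i p) (D p u Y)) =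
      tadd (tscale (u ?i) (Z p)) (tscale (?i p) (D p u Z))"
    unfolding conn_leibniz[OF Y p i, symmetric] conn_leibniz[OF Z p i, symmetric]
    by (rule arg_cong)
  then show ?thesis
    using p(1) eq[OF p(1)] by (simp add: tadd_def tscale_def fun_eq_iff)
qed

text \<open>Torsion-freeness writes the bracket as a difference of covariant derivatives, which are
  tangent by the axioms; this replaces a direct check of the product rule.\<close>

lemma lie_bracket_tangent:
  "vector_field M A W Y \<Longrightarrow> vector_field M A W Z \<Longrightarrow> p \<in> W \<Longrightarrow>
    lie_bracket M A Y Z p \<in> tangent_space M A p"
  using conn_torsion_free conn_tangent vector_field_tangent tdiff_tangent by metis

lemma curvature_field_tangent:
  assumes "vector_field M A W E" "vector_field M A W V" "vector_field M A W Z" "p \<in> W"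
  shows "curvature_field M A D E V Z p \<in> tangent_space M A p"
  unfolding curvature_field_def
  by (intro tdiff_tangent conn_tangent[OF conn_smooth] conn_tangent[OF assms(3)] lie_bracket_tangent
      vector_field_tangent) (rule assms)+

text \<open>The two mixed terms are exchanged when \<open>E\<close> and \<open>V\<close> are
  swapped, so they cancel in the commutator of the two derivatives.\<close>

lemma second_derivative_metric:
  assumes E: "vector_field M A W E" and V: "vector_field M A W V"
    and Z: "vector_field M A W Z" and F: "vector_field M A W F" and p: "p \<in> W"
  shows "E p (\<lambda>q. V q (\<lambda>r. g r (Z r) (F r))) =
    g p (D p (E p) (\<lambda>q. D q (V q) Z)) (F p) + g p (D p (V p) Z) (D p (E p) F) +
    (g p (D p (E p) Z) (D p (V p) F) + g p (Z p) (D p (E p) (\<lambda>q. D q (V q) F)))"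
proof -
  let ?VZ = "\<lambda>q. D q (V q) Z" and ?VF = "\<lambda>q. D q (V q) F"
  have VZ: "vector_field M A W ?VZ" and VF: "vector_field M A W ?VF"
    using conn_smooth Z F V by blast+
  note e = vector_field_tangent[OF E p]
  have "E p (\<lambda>q. V q (\<lambda>r. g r (Z r) (F r))) =
      E p (\<lambda>q. g q (?VZ q) (F q) + g q (Z q) (?VF q))"
    by (rule tangent_local[OF e vector_field_openin[OF E] p])
       (rule conn_metric[OF Z F _ vector_field_tangent[OF V]])
  also have "\<dots> = E p (\<lambda>q. g q (?VZ q) (F q)) + E p (\<lambda>q. g q (Z q) (?VF q))"
    by (rule tangent_add[OF e smooth_nearI[OF metric_smooth[OF VZ F] p]
          smooth_nearI[OF metric_smooth[OF Z VF] p]])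
  finally show ?thesis
    by (simp add: conn_metric[OF VZ F p e] conn_metric[OF Z VF p e])
qed

text \<open>The derivative of \<open>g(Z,F)\<close> along \<open>[E,V]\<close> is computed twice: by
  metric compatibility, and as the commutator of the derivatives along \<open>E\<close> and
  \<open>V\<close>. The difference of the two results is the claim.\<close>

lemma curvature_field_skew:
  assumes E: "vector_field M A W E" and V: "vector_field M A W V"
    and Z: "vector_field M A W Z" and F: "vector_field M A W F" and p: "p \<in> W"
  shows "g p (curvature_field M A D E V Z p) (F p) = - g p (curvature_field M A D E V F p) (Z p)"
proof -
  let ?b = "lie_bracket M A E V p"
  note t = vector_field_tangent[OF _ p] conn_tangent[OF _ p] vector_field_topspace[OF E p]
  have b: "?b \<in> tangent_space M A p" using lie_bracket_tangent[OF E V p] .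
  \<comment> \<open>\<open>lie_bracket\<close> is the commutator only on functions smooth near
    \<open>p\<close>, hence the appeal to \<open>metric_smooth\<close>.\<close>
  have "?b (\<lambda>q. g q (Z q) (F q)) =
      E p (\<lambda>q. V q (\<lambda>r. g r (Z r) (F r))) - V p (\<lambda>q. E q (\<lambda>r. g r (Z r) (F r)))"
    using smooth_nearI[OF metric_smooth[OF Z F] p] by (simp add: lie_bracket_def)
  then have "g p (D p ?b Z) (F p) + g p (Z p) (D p ?b F) =
      E p (\<lambda>q. V q (\<lambda>r. g r (Z r) (F r))) - V p (\<lambda>q. E q (\<lambda>r. g r (Z r) (F r)))"
    using conn_metric[OF Z F p b] by simp
  moreover have "g p (curvature_field M A D E V Y p) (Y' p) =
      g p (D p (E p) (\<lambda>q. D q (V q) Y)) (Y' p) - g p (D p (V p) (\<lambda>q. D q (E q) Y)) (Y' p)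
        - g p (D p ?b Y) (Y' p)"
    if "vector_field M A W Y" "vector_field M A W Y'" for Y Y'
    unfolding curvature_field_def
    using that E V b by (simp add: metric_diff_left t tdiff_tangent conn_smooth)
  moreover have "g p (Z p) w = g p w (Z p)" if "w \<in> tangent_space M A p" for w
    using metric_sym[OF t(3) t(1)[OF Z] that] .
  ultimately show ?thesis
    using second_derivative_metric[OF E V Z F p] second_derivative_metric[OF V E Z F p] E V Z F b
    by (simp add: t conn_smooth)
qed

text \<open>By \<open>tangent_eq_coord_vec\<close> and \<open>coord_vec_inj\<close>, coordinates
  identify the tangent space with \<open>real ^ 'n\<close>, and the metric becomes the positive
  definite form \<open>B\<close>. The expansion is evaluated at \<open>f\<close>, the form in which
  traces are summed later.\<close>

lemma
  assumes p: "p \<in> topspace M"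
  shows orthonormal_basis_exists: "\<exists>e. orthonormal_basis M A g p e"
    and orthonormal_basis_expand: "\<And>e v f. orthonormal_basis M A g p e \<Longrightarrow>
      v \<in> tangent_space M A p \<Longrightarrow> v f = (\<Sum>i\<in>UNIV. g p v (e i) * e i f)"
proof -
  obtain U \<phi> where c: "(U, \<phi>) \<in> A" "p \<in> U"
    using chart_around[OF p] .
  interpret smooth_chart M A U \<phi> by unfold_locales (rule c)
  define B where "B x y = g p (coord_vec x p) (coord_vec y p)" for x y
  note t = coord_vec_tangent[OF c(2)]
  interpret B: pos_def_form B
  proof
    show "bilinear B"
      unfolding bilinear_def B_def
      by (auto intro!: linearI simp: coord_vec_add[OF c(2)] coord_vec_scale[OF c(2)]
          metric_add_left metric_add_right metric_scale_left metric_scale_right p t)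
    show "B x y = B y x" for x y
      unfolding B_def by (rule metric_sym[OF p t t])
    show "B x x > 0" if "x \<noteq> 0" for x
    proof -
      have "coord_vec x p \<noteq> coord_vec 0 p"
        using coord_vec_inj[OF c(2)] that by blast
      moreover have "coord_vec 0 p = tzero"
        using coord_vec_scale[OF c(2), of 0 0] by (simp add: tscale_def tzero_def)
      ultimately show ?thesis
        unfolding B_def using metric_pos[OF p t] by metis
    qed
  qed
  obtain S where S: "B.orthonormal S" "card S = CARD('n)"
    using B.orthonormal_exists[of "CARD('n)"] by auto
  then obtain b where b: "bij_betw b (UNIV :: 'n set) S"
    using finite_same_card_bij[of "UNIV :: 'n set" S] by (auto simp: B.orthonormal_def)
  have "orthonormal_basis M A g p (\<lambda>i. coord_vec (b i) p)"
    using S(1) b t by (auto simp: orthonormal_basis_def B.orthonormal_def B_def bij_betw_def inj_def)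
  then show "\<exists>e. orthonormal_basis M A g p e" by blast
  fix e :: "'n \<Rightarrow> 'a tangent" and v f
  assume e: "orthonormal_basis M A g p e" and v: "v \<in> tangent_space M A p"
  define x where "x i = (\<chi> j. e i (\<lambda>q. \<phi> q $ j))" for i
  have x: "e i = coord_vec (x i) p" for i
    unfolding x_def using e by (intro tangent_eq_coord_vec[OF c(2)]) (simp add: orthonormal_basis_def)
  define y where "y = (\<chi> j. v (\<lambda>q. \<phi> q $ j))"
  have y: "v = coord_vec y p"
    unfolding y_def by (rule tangent_eq_coord_vec[OF c(2) v])
  have Bx: "B (x i) (x j) = (if i = j then 1 else 0)" for i j
    using e by (simp add: orthonormal_basis_def B_def x)
  have inj: "inj x"
    using Bx by (metis injI zero_neq_one)
  have "B.orthonormal (range x)"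
    using Bx inj by (auto simp: B.orthonormal_def inj_def)
  then have "y = (\<Sum>s\<in>range x. B y s *\<^sub>R s)"
    by (rule B.orthonormal_expand) (simp add: card_image[OF inj])
  then have "y = (\<Sum>i\<in>UNIV. B y (x i) *\<^sub>R x i)"
    by (simp add: sum.reindex[OF inj])
  then have "v f = coord_vec (\<Sum>i\<in>UNIV. B y (x i) *\<^sub>R x i) p f"
    using y by metis
  also have "\<dots> = (\<Sum>i\<in>UNIV. g p v (e i) * e i f)"
    by (simp add: coord_vec_sum[OF c(2)] coord_vec_scale[OF c(2)] tscale_def B_def x y)
  finally show "v f = (\<Sum>i\<in>UNIV. g p v (e i) * e i f)" .
qed

end


section \<open>Closed conformal fields\<close>

text \<open>Here \<open>\<psi>\<close> is any function satisfying the closedness equation; it is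
  identified with the scalar curvature minus \<open>\<rho>\<close> when the locale is
  interpreted.\<close>

locale closed_conformal = riemannian_mfd M A g D
  for M :: "'a topology" and A :: "('a, 'n::finite) chart set"
    and g :: "'a \<Rightarrow> 'a tangent \<Rightarrow> 'a tangent \<Rightarrow> real"
    and D :: "'a \<Rightarrow> 'a tangent \<Rightarrow> ('a \<Rightarrow> 'a tangent) \<Rightarrow> 'a tangent" +
  fixes X :: "'a \<Rightarrow> 'a tangent" and \<psi> :: "'a \<Rightarrow> real"
  assumes X_field: "vector_field M A (topspace M) X"
    and closed: "p \<in> topspace M \<Longrightarrow> v \<in> tangent_space M A p \<Longrightarrow> D p v X = tscale (\<psi> p) v"
begin

abbreviation a :: "'a \<Rightarrow> real" where "a q \<equiv> g q (X q) (X q)"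
abbreviation b :: "'a \<Rightarrow> real" where "b q \<equiv> X q \<psi>"

lemma X_on: "vector_field M A W Y \<Longrightarrow> vector_field M A W X"
  by (rule vector_field_subset[OF X_field vector_field_openin openin_subset[OF vector_field_openin]])

text \<open>In a chart, \<open>\<psi>\<close> is a component of \<open>\<nabla>\<^bsub>V\<^esub> X\<close> for the field \<open>V\<close> all of whose components are
  \<open>1\<close>. Hence \<open>\<psi>\<close> is smooth, without an argument for the scalar curvature.\<close>

lemma psi_smooth:
  assumes "p \<in> topspace M"
  obtains W where "p \<in> W" "smooth_fun M A W \<psi>"
proof -
  obtain U \<phi> where c: "(U, \<phi>) \<in> A" "p \<in> U"
    using chart_around[OF assms] .
  interpret smooth_chart M A U \<phi> by unfold_locales (rule c)
  let ?V = "coord_vec 1"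
  have V: "vector_field M A U ?V" by (rule vector_field_coord_vec)
  \<comment> \<open>\<open>undefined\<close> is merely some coordinate index; every component of
    \<open>?V\<close> is \<open>1\<close>.\<close>
  have "smooth_fun M A U (\<lambda>q. D q (?V q) X (\<lambda>r. \<phi> r $ undefined))"
    by (rule vector_field_smooth[OF conn_smooth[OF X_on[OF V] V] smooth_fun_coord[OF chart] order_refl])
  then have "smooth_fun M A U \<psi>"
    by (rule smooth_fun_cong)
       (simp add: closed vector_field_topspace[OF V] coord_vec_tangent tscale_def coord_vec_coord)
  then show ?thesis using that c(2) by blast
qed

text \<open>Closedness replaces covariant derivatives of \<open>X\<close> by multiples by
  \<open>\<psi>\<close>. After the Leibniz rule, the terms carrying \<open>\<psi> p\<close> cancel
  by torsion-freeness and only derivatives of \<open>\<psi>\<close> remain.\<close>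

lemma curvature_field_X:
  assumes E: "vector_field M A W E" and V: "vector_field M A W V" and p: "p \<in> W"
    and \<psi>: "smooth_fun M A W \<psi>"
  shows "curvature_field M A D E V X p = tdiff (tscale (E p \<psi>) (V p)) (tscale (V p \<psi>) (E p))"
proof -
  have deriv: "D p (Y p) (\<lambda>q. D q (Z q) X) = tadd (tscale (Y p \<psi>) (Z p)) (tscale (\<psi> p) (D p (Y p) Z))"
    if Y: "vector_field M A W Y" and Z: "vector_field M A W Z" for Y Z
  proof -
    \<comment> \<open>The two differentiated fields agree only on \<open>W\<close>, so this needs
      \<open>conn_local\<close>.\<close>
    have "D p (Y p) (\<lambda>q. D q (Z q) X) = D p (Y p) (\<lambda>q. tscale (\<psi> q) (Z q))"
      by (rule conn_local[OF conn_smooth[OF X_on[OF Z] Z] p vector_field_tangent[OF Y p]])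
         (rule closed[OF vector_field_topspace[OF Z] vector_field_tangent[OF Z]])
    also have "\<dots> = tadd (tscale (Y p \<psi>) (Z p)) (tscale (\<psi> p) (D p (Y p) Z))"
      by (rule conn_leibniz[OF Z p vector_field_tangent[OF Y p] \<psi>])
    finally show ?thesis .
  qed
  show ?thesis
    unfolding curvature_field_def deriv[OF E V] deriv[OF V E]
      closed[OF vector_field_topspace[OF E p] lie_bracket_tangent[OF E V p]]
    unfolding conn_torsion_free[OF E V p]
    by (simp add: tdiff_def tadd_def tscale_def fun_eq_iff algebra_simps)
qed

text \<open>By skew-symmetry the third argument may be replaced by a multiple of \<open>X\<close> with the same value.\<close>

lemma curvature_field_parallel_X:
  assumes E: "vector_field M A W E" and V: "vector_field M A W V"
    and Z: "vector_field M A W Z" and F: "vector_field M A W F" and p: "p \<in> W"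
    and \<psi>: "smooth_fun M A W \<psi>" and Zp: "Z p = tscale c (X p)"
  shows "g p (curvature_field M A D E V Z p) (F p) =
    c * (E p \<psi> * g p (V p) (F p) - V p \<psi> * g p (E p) (F p))"
proof -
  note t = vector_field_tangent[OF _ p] vector_field_topspace[OF E p]
  note X = X_on[OF E]
  have "g p (curvature_field M A D E V Z p) (F p) = - g p (curvature_field M A D E V F p) (Z p)"
    by (rule curvature_field_skew[OF E V Z F p])
  also have "\<dots> = - (c * g p (curvature_field M A D E V F p) (X p))"
    by (simp add: Zp metric_scale_right t(1)[OF X] t(2) curvature_field_tangent[OF E V F p])
  also have "\<dots> = c * g p (curvature_field M A D E V X p) (F p)"
    by (simp add: curvature_field_skew[OF E V F X p])
  also have "\<dots> = c * (E p \<psi> * g p (V p) (F p) - V p \<psi> * g p (E p) (F p))"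
    by (simp add: curvature_field_X[OF E V p \<psi>] metric_diff_left metric_scale_left tscale_tangent
        t(1)[OF E] t(1)[OF V] t(1)[OF F] t(2))
  finally show ?thesis .
qed

section \<open>Gradient and Hessian of \<open>\<psi>\<close>\<close>

lemma fields_around:
  assumes p: "p \<in> topspace M" and u: "u \<in> tangent_space M A p" and v: "v \<in> tangent_space M A p"
  obtains W where "p \<in> W" "smooth_fun M A W \<psi>" "vector_field M A W (extension M A p u)"
    "vector_field M A W (extension M A p v)" "extension M A p u p = u" "extension M A p v p = v"
proof -
  obtain W1 where W1: "p \<in> W1" "smooth_fun M A W1 \<psi>" using psi_smooth[OF p] .
  obtain W2 where W2: "p \<in> W2" "vector_field M A W2 (extension M A p u)" "extension M A p u p = u"
    using extension_vector_field[OF p u] .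
  obtain W3 where W3: "p \<in> W3" "vector_field M A W3 (extension M A p v)" "extension M A p v p = v"
    using extension_vector_field[OF p v] .
  have W: "openin M (W1 \<inter> W2 \<inter> W3)"
    by (intro openin_Int smooth_fun_openin[OF W1(2)] vector_field_openin[OF W2(2)]
        vector_field_openin[OF W3(2)])
  show ?thesis
  proof (rule that[OF _ _ _ _ W2(3) W3(3)])
    show "p \<in> W1 \<inter> W2 \<inter> W3" using W1 W2 W3 by simp
    show "smooth_fun M A (W1 \<inter> W2 \<inter> W3) \<psi>"
      by (rule smooth_fun_subset[OF W1(2) W]) auto
    show "vector_field M A (W1 \<inter> W2 \<inter> W3) (extension M A p u)"
      by (rule vector_field_subset[OF W2(2) W]) auto
    show "vector_field M A (W1 \<inter> W2 \<inter> W3) (extension M A p v)"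
      by (rule vector_field_subset[OF W3(2) W]) auto
  qed
qed

text \<open>With the factor \<open>a\<close> the identity holds at zeros of \<open>X\<close> as
  well, so it is an equality of functions on a neighbourhood and can be differentiated.\<close>

lemma psi_gradient:
  assumes p: "p \<in> topspace M" and v: "v \<in> tangent_space M A p"
  shows "a p * v \<psi> = b p * g p v (X p)"
proof -
  let ?V = "extension M A p v"
  obtain W where W: "p \<in> W" "smooth_fun M A W \<psi>" "vector_field M A W ?V" "?V p = v"
    using fields_around[OF p v v] .
  note X = X_on[OF W(3)]
  \<comment> \<open>Skew-symmetry with both fields equal to \<open>X\<close>: the number is its own
    negative.\<close>
  have "g p (curvature_field M A D X ?V X p) (X p) = 0"
    using curvature_field_skew[OF X W(3) X X W(1)] by simp
  then show ?thesis
    using curvature_field_parallel_X[OF X W(3) X X W(1,2), of 1] W(4)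
    by (simp add: tscale_def mult.commute)
qed

lemma hessian_psi:
  assumes p: "p \<in> topspace M" and w: "w \<in> tangent_space M A p" and v: "v \<in> tangent_space M A p"
  shows "a p * hessian M A D \<psi> p w v =
    w b * g p v (X p) + b p * \<psi> p * g p v w - 2 * \<psi> p * g p w (X p) * v \<psi>"
proof -
  let ?V = "extension M A p v"
  obtain W where W: "p \<in> W" "smooth_fun M A W \<psi>" "vector_field M A W ?V" "?V p = v"
    using fields_around[OF p v v] .
  note X = X_on[OF W(3)]
  note Xp = vector_field_tangent[OF X W(1)]
  have sa: "smooth_near M A p a"
    using smooth_nearI[OF metric_smooth[OF X X] W(1)] .
  have sb: "smooth_near M A p b"
    using smooth_nearI[OF vector_field_smooth[OF X W(2)] W(1)] by simp
  have sV: "smooth_near M A p (\<lambda>q. ?V q \<psi>)"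
    using smooth_nearI[OF vector_field_smooth[OF W(3) W(2)] W(1)] by simp
  have sVX: "smooth_near M A p (\<lambda>q. g q (?V q) (X q))"
    using smooth_nearI[OF metric_smooth[OF W(3) X] W(1)] .
  have "w (\<lambda>q. a q * ?V q \<psi>) = w (\<lambda>q. b q * g q (?V q) (X q))"
    by (rule tangent_local[OF w vector_field_openin[OF X] W(1)])
       (rule psi_gradient[OF vector_field_topspace[OF X] vector_field_tangent[OF W(3)]])
  then have "a p * w (\<lambda>q. ?V q \<psi>) + v \<psi> * w a =
      b p * w (\<lambda>q. g q (?V q) (X q)) + g p v (X p) * w b"
    by (simp add: tangent_mult[OF w sa sV] tangent_mult[OF w sb sVX] W(4))
  moreover have "w a = 2 * \<psi> p * g p w (X p)"
    by (simp add: conn_metric[OF X X W(1) w] closed p w Xp metric_scale_left metric_scale_right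
        metric_sym[of p "X p" w])
  moreover have "w (\<lambda>q. g q (?V q) (X q)) = g p (D p w ?V) (X p) + \<psi> p * g p v w"
    by (simp add: conn_metric[OF W(3) X W(1) w] closed p w v metric_scale_right W(4))
  \<comment> \<open>The gradient identity, applied to the tangent vector \<open>D p w ?V\<close>,
    cancels the derivative of the chosen extension from both sides.\<close>
  moreover have "a p * D p w ?V \<psi> = b p * g p (D p w ?V) (X p)"
    by (rule psi_gradient[OF p conn_tangent[OF W(3,1) w]])
  ultimately show ?thesis
    by (simp add: hessian_def Let_def algebra_simps)
qed

lemma hessian_ricci_laplacian:
  assumes p: "p \<in> topspace M" and X: "X p \<noteq> tzero"
  defines "u \<equiv> tscale (1 / sqrt (a p)) (X p)"
  shows "hessian M A D \<psi> p u u - \<psi> p * ricci M A g D p u u = laplacian M A g D \<psi> p"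
    and "g p u u = 1"
proof -
  define c where "c = 1 / sqrt (a p)"
  have Xp: "X p \<in> tangent_space M A p"
    using vector_field_tangent[OF X_field p] .
  have a: "a p > 0" using metric_pos[OF p Xp X] .
  have c: "a p * (c * c) = 1" using a by (simp add: c_def)
  have u: "u = tscale c (X p)" "u \<in> tangent_space M A p"
    by (simp_all add: u_def c_def tscale_tangent Xp)
  have guX: "g p u (X p) = c * a p"
    by (simp add: u metric_scale_left p Xp)
  show guu: "g p u u = 1"
    using c by (simp add: u metric_scale_left metric_scale_right p Xp tscale_tangent mult_ac)
  \<comment> \<open>This is the same \<open>SOME\<close> term as in \<open>metric_trace\<close>, so
    the Ricci trace and the Laplacian both unfold to sums over this \<open>e\<close>.\<close>
  define e :: "'n \<Rightarrow> 'a tangent" where "e = (SOME e. orthonormal_basis M A g p e)"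
  have e: "orthonormal_basis M A g p e"
    unfolding e_def by (rule someI_ex[OF orthonormal_basis_exists[OF p]])
  then have et: "e i \<in> tangent_space M A p" and ee: "g p (e i) (e i) = 1" for i
    by (simp_all add: orthonormal_basis_def)
  \<comment> \<open>Used with \<open>v = u\<close> and \<open>v = X p\<close>, it collapses a
    weighted sum of derivatives along the basis to one derivative along \<open>v\<close>.\<close>
  have parseval: "(\<Sum>i\<in>UNIV. g p (e i) v * e i f) = v f" if "v \<in> tangent_space M A p" for v f
    using orthonormal_basis_expand[OF p e that, of f] metric_sym[OF p that et] by simp
  let ?n = "real CARD('n)"
  have "ricci M A g D p u u = (\<Sum>i\<in>UNIV. c * (e i \<psi> * g p u (e i) - u \<psi>))"
    unfolding ricci_def metric_trace_def Let_def e_def[symmetric]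
  proof (rule sum.cong[OF refl])
    fix i
    obtain W where W: "p \<in> W" "smooth_fun M A W \<psi>" "vector_field M A W (extension M A p (e i))"
      "vector_field M A W (extension M A p u)" "extension M A p (e i) p = e i" "extension M A p u p = u"
      using fields_around[OF p et u(2)] .
    show "g p (curvature M A D p (e i) u u) (e i) = c * (e i \<psi> * g p u (e i) - u \<psi>)"
      using curvature_field_parallel_X[OF W(3,4,4,3,1,2), of c] W(5,6) u(1) ee
      by (simp add: curvature_def)
  qed
  \<comment> \<open>The sum collapses to a single \<open>u \<psi>\<close>, against which stand
    \<open>?n\<close> copies of \<open>u \<psi>\<close>: this is the source of the factor
    \<open>?n - 1\<close>.\<close>
  also have "\<dots> = c * ((\<Sum>i\<in>UNIV. g p (e i) u * e i \<psi>) - ?n * u \<psi>)"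
    by (simp add: sum_subtractf sum_distrib_left[symmetric] metric_sym[OF p u(2) et] mult.commute)
  also have "\<dots> = - ((?n - 1) * (c * c) * b p)"
    by (subst parseval[OF u(2)]) (simp add: u tscale_def algebra_simps)
  finally have ric: "a p * ricci M A g D p u u = - (?n - 1) * b p"
    using c by algebra
  \<comment> \<open>In the first and last terms of \<open>hessian_psi\<close> the two scalings by
    \<open>c\<close> meet a factor \<open>a p\<close>, and \<open>a p * (c * c) = 1\<close>; in the
    middle term \<open>g p u u = 1\<close>.\<close>
  have hess: "a p * hessian M A D \<psi> p u u = X p b + b p * \<psi> p - 2 * \<psi> p * b p"
    unfolding hessian_psi[OF p u(2) u(2)] guX guu
    using c by (simp add: u(1) tscale_def) algebra
  have "a p * laplacian M A g D \<psi> p = (\<Sum>i\<in>UNIV. a p * hessian M A D \<psi> p (e i) (e i))"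
    by (simp add: laplacian_def metric_trace_def Let_def e_def[symmetric] sum_distrib_left)
  also have "\<dots> = (\<Sum>i\<in>UNIV. g p (e i) (X p) * e i b) + ?n * (b p * \<psi> p) -
      2 * \<psi> p * (\<Sum>i\<in>UNIV. g p (e i) (X p) * e i \<psi>)"
    by (simp add: hessian_psi[OF p et et] ee sum.distrib sum_subtractf sum_distrib_left mult_ac)
  also have "\<dots> = X p b + ?n * (b p * \<psi> p) - 2 * \<psi> p * b p"
    by (simp only: parseval[OF Xp])
  finally have "a p * (hessian M A D \<psi> p u u - \<psi> p * ricci M A g D p u u) =
      a p * laplacian M A g D \<psi> p"
    using ric hess by algebra
  then show "hessian M A D \<psi> p u u - \<psi> p * ricci M A g D p u u = laplacian M A g D \<psi> p"
    using a by simp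
qed

end

theorem theorem1p4:
  fixes M :: "'a topology"
    and A :: "('a, 'n::finite) chart set"
    and g :: "'a \<Rightarrow> 'a tangent \<Rightarrow> 'a tangent \<Rightarrow> real"
    and D :: "'a \<Rightarrow> 'a tangent \<Rightarrow> ('a \<Rightarrow> 'a tangent) \<Rightarrow> 'a tangent"
    and X :: "'a \<Rightarrow> 'a tangent"
    and \<rho> \<psi> :: "'a \<Rightarrow> real"
  assumes "CARD('n) \<ge> 2"
    and "almost_yamabe_soliton M A g D X \<rho>"
    and "\<psi> = (\<lambda>p. scalar_curvature M A g D p - \<rho> p)"
    and "closed_soliton_field M A g D X \<rho>"
  shows "killing_soliton_field M A g D X \<rho> \<or>
    (\<forall>p\<in>topspace M. X p \<noteq> tzero \<longrightarrow>
      (let n = real CARD('n);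
           R = scalar_curvature M A g D p;
           u = tscale (1 / sqrt (g p (X p) (X p))) (X p)
       in hessian M A D \<psi> p u u + R * \<psi> p / (n - 1) * g p u u - \<psi> p * ricci M A g D p u u
          = laplacian M A g D \<psi> p + R * \<psi> p / (n - 1)))"
proof -
  interpret closed_conformal M A g D X \<psi>
    using assms(2-4)
    by unfold_locales (auto simp: almost_yamabe_soliton_def closed_soliton_field_def)
  show ?thesis
    \<comment> \<open>As \<open>g p u u = 1\<close>, the term \<open>R * \<psi> p / (n - 1)\<close>
      is the same on both sides and cancels, leaving the traced identity.\<close>
    using hessian_ricci_laplacian by (simp add: Let_def algebra_simps)
qed

end
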